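(* Let $(X,\ll,\leq,\mathfrak T)$ be a topological causal space and let $H\subset X$ be a null non-branching, weakly convex, closed achronal set admitting a gauge function $G$. Let $\mu_0,\mu_1$ be Borel probability measures on $H^\circ$ and assume that there exists a causal coupling $\pi\in\Pi_\le(\mu_0,\mu_1)$. Then there exists a unique $G$-causal dynamical transport plan $\nu\in\mathrm{OptGeo}^G(\mu_0,\mu_1)$ such that $(e_0,e_1)_\sharp\nu=\pi$.
   Context: A causal space $(X,\ll,\le)$ is a set $X$ with a preorder $\le$ and a transitive relation $\ll$ contained in $\le$. A topological causal space $(X,\ll,\leq,\mathfrak T)$ is a causal space with a Polish topology $\mathfrak T$ induced by a separable proper metric (closed balls are compact), such that $J:=\{(x,y):x\le y\}$ is closed and $\{(x,y):x\ll y\}$ is open in $X\times X$. A set $H$ is achronal if no $x,y\in H$ satisfy $x\ll y$. A causal curve is a continuous $\gamma:I\to X$ ($I$ an interval) with $\gamma_s\le\gamma_t$ for all $s\le t$ (constant curves allowed). $H$ is weakly convex if any $x,y\in H$ with $x\le y$ are joined by a causal curve contained in $H$. For a closed achronal set $H$: $\mathfrak a=\{m\in H:\nexists x\in H,\ x\le m,\ x\ne m\}$; $\mathfrak b=\{m\in H:\nexists x\in H,\ m\le x,\ x\neq m\}$; $H^\circ=H\setminus(\mathfrak a\cup\mathfrak b)$. A gauge for $H$ is a Borel map $G:H^\circ\to\mathbb R$ such that (1) for any injective causal curve $\gamma$ in $H^\circ$, $G\circ\gamma$ is strictly increasing and continuous; (2) for any causal $\gamma:[0,1]\to H$ with $\gamma((0,1))\subset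 H^\circ$, $\sup_{(0,1)}G\circ\gamma$ and $\inf_{(0,1)}G\circ\gamma$ are finite. A curve $\gamma:[0,1]\to H$ is $G$-causal if it is constant, or it is causal with $\gamma((0,1))\subset H^\circ$ and $G\circ\gamma|_{(0,1)}$ affine; $\mathrm{Caus}_G\subset C([0,1];H)$ is the set of $G$-causal curves. $H$ is forward null non-branching if for every pair of injective causal curves $\gamma^1,\gamma^2:[0,1]\to H$ with $\gamma^1_0=\gamma^2_0$ and $\gamma^1_{1/2}=\gamma^2_{1/2}$, either $\gamma^1([0,1])\subset\gamma^2([0,1])$ or $\gamma^2([0,1])\subset\gamma^1([0,1])$; backward null non-branching if it is forward null non-branching for the reversed causal relations; null non-branching if both. $\Pi_\le(\mu_0,\mu_1)$ is the set of couplings $\pi$ of $\mu_0,\mu_1$ with $\pi(J)=1$. $\mathrm{OptGeo}^G(\mu_0,\mu_1)$ is the set of Borel probability measures $\nu$ on $C([0,1];H)$ (uniform topology) with $(e_i)_\sharp\nu=\mu_i$, $i=0,1$, and $\nu(\mathrm{Caus}_G)=1$, where $e_t(\gamma)=\gamma_t$. *)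

theory Defs
  imports "HOL-Probability.Probability"
begin

locale causal_space =
  fixes chron caus :: "'a \<Rightarrow> 'a \<Rightarrow> bool"
  assumes caus_refl: "reflp caus"
    and caus_trans: "transp caus"
    and chron_trans: "transp chron"
    and chron_imp_caus: "chron x y \<Longrightarrow> caus x y"

text \<open>The space is the whole type; the metric of the type class is the proper metric inducing the
  topology. All notions below depend on it only through its topology.\<close>

locale topological_causal_space = causal_space chron caus
  for chron caus :: "'a::polish_space \<Rightarrow> 'a \<Rightarrow> bool" +
  assumes proper: "compact (cball (x::'a) r)"
    and closed_caus: "closed {(x, y). caus x y}"
    and open_chron: "open {(x, y). chron x y}"

definition achronal :: "('a \<Rightarrow> 'a \<Rightarrow> bool) \<Rightarrow> 'a set \<Rightarrow> bool" where
  "achronal chron H \<longleftrightarrow> \<not> (\<exists>x\<in>H. \<exists>y\<in>H. chron x y)"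

definition causal_curve ::
    "('a::topological_space \<Rightarrow> 'a \<Rightarrow> bool) \<Rightarrow> real set \<Rightarrow> 'a set \<Rightarrow> (real \<Rightarrow> 'a) \<Rightarrow> bool" where
  "causal_curve caus I S \<gamma> \<longleftrightarrow>
     is_interval I \<and> continuous_on I \<gamma> \<and> \<gamma> ` I \<subseteq> S \<and>
     (\<forall>s\<in>I. \<forall>t\<in>I. s \<le> t \<longrightarrow> caus (\<gamma> s) (\<gamma> t))"

definition weakly_convex :: "('a::topological_space \<Rightarrow> 'a \<Rightarrow> bool) \<Rightarrow> 'a set \<Rightarrow> bool" where
  "weakly_convex caus H \<longleftrightarrow>
     (\<forall>x\<in>H. \<forall>y\<in>H. caus x y \<longrightarrow>
        (\<exists>\<gamma>. causal_curve caus {0..1} H \<gamma> \<and> \<gamma> 0 = x \<and> \<gamma> 1 = y))"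

definition initial_points :: "('a \<Rightarrow> 'a \<Rightarrow> bool) \<Rightarrow> 'a set \<Rightarrow> 'a set" where
  "initial_points caus H = {m\<in>H. \<not> (\<exists>x\<in>H. caus x m \<and> x \<noteq> m)}"

definition final_points :: "('a \<Rightarrow> 'a \<Rightarrow> bool) \<Rightarrow> 'a set \<Rightarrow> 'a set" where
  "final_points caus H = {m\<in>H. \<not> (\<exists>x\<in>H. caus m x \<and> x \<noteq> m)}"

definition inner_points :: "('a \<Rightarrow> 'a \<Rightarrow> bool) \<Rightarrow> 'a set \<Rightarrow> 'a set" where
  "inner_points caus H = H - (initial_points caus H \<union> final_points caus H)"

text \<open>A gauge is a map on \<open>inner_points caus H\<close> only; its values elsewhere are irrelevant. In the
  last clause, finiteness of the supremum and infimum is expressed by boundedness.\<close>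

definition gauge_for ::
    "('a::topological_space \<Rightarrow> 'a \<Rightarrow> bool) \<Rightarrow> 'a set \<Rightarrow> ('a \<Rightarrow> real) \<Rightarrow> bool" where
  "gauge_for caus H G \<longleftrightarrow>
     G \<in> borel_measurable (restrict_space borel (inner_points caus H)) \<and>
     (\<forall>I \<gamma>. causal_curve caus I (inner_points caus H) \<gamma> \<and> inj_on \<gamma> I \<longrightarrow>
        strict_mono_on I (G \<circ> \<gamma>) \<and> continuous_on I (G \<circ> \<gamma>)) \<and>
     (\<forall>\<gamma>. causal_curve caus {0..1} H \<gamma> \<and> \<gamma> ` {0<..<1} \<subseteq> inner_points caus H \<longrightarrow>
        bdd_above ((G \<circ> \<gamma>) ` {0<..<1}) \<and> bdd_below ((G \<circ> \<gamma>) ` {0<..<1}))"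

definition forward_null_nonbranching ::
    "('a::topological_space \<Rightarrow> 'a \<Rightarrow> bool) \<Rightarrow> 'a set \<Rightarrow> bool" where
  "forward_null_nonbranching caus H \<longleftrightarrow>
     (\<forall>\<gamma>1 \<gamma>2. causal_curve caus {0..1} H \<gamma>1 \<and> inj_on \<gamma>1 {0..1} \<and>
        causal_curve caus {0..1} H \<gamma>2 \<and> inj_on \<gamma>2 {0..1} \<and>
        \<gamma>1 0 = \<gamma>2 0 \<and> \<gamma>1 (1/2) = \<gamma>2 (1/2) \<longrightarrow>
        \<gamma>1 ` {0..1} \<subseteq> \<gamma>2 ` {0..1} \<or> \<gamma>2 ` {0..1} \<subseteq> \<gamma>1 ` {0..1})"

definition backward_null_nonbranching ::
    "('a::topological_space \<Rightarrow> 'a \<Rightarrow> bool) \<Rightarrow> 'a set \<Rightarrow> bool" where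
  "backward_null_nonbranching caus H \<longleftrightarrow> forward_null_nonbranching (\<lambda>x y. caus y x) H"

definition null_nonbranching :: "('a::topological_space \<Rightarrow> 'a \<Rightarrow> bool) \<Rightarrow> 'a set \<Rightarrow> bool" where
  "null_nonbranching caus H \<longleftrightarrow>
     forward_null_nonbranching caus H \<and> backward_null_nonbranching caus H"

text \<open>The space \<open>C([0,1];H)\<close> with the sup metric. Its points are continuous functions on
  \<open>{0..1}\<close> with values in \<open>H\<close>, made unique as total functions by being \<open>undefined\<close> off \<open>{0..1}\<close>.\<close>

definition curve_space :: "'a::metric_space set \<Rightarrow> (real \<Rightarrow> 'a) metric" where
  "curve_space H = cfunspace (top_of_set {0..1}) (submetric euclidean_metric H)"

definition borel_of_topology :: "'b topology \<Rightarrow> 'b measure" where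
  "borel_of_topology T = sigma (topspace T) {U. openin T U}"

definition Caus_G ::
    "('a::metric_space \<Rightarrow> 'a \<Rightarrow> bool) \<Rightarrow> 'a set \<Rightarrow> ('a \<Rightarrow> real) \<Rightarrow> (real \<Rightarrow> 'a) set" where
  "Caus_G caus H G = {\<gamma> \<in> mspace (curve_space H).
     (\<exists>x. \<forall>t\<in>{0..1}. \<gamma> t = x) \<or>
     (causal_curve caus {0..1} H \<gamma> \<and> \<gamma> ` {0<..<1} \<subseteq> inner_points caus H \<and>
      (\<exists>a b. \<forall>t\<in>{0<..<1}. G (\<gamma> t) = a * t + b))}"

text \<open>Borel probability measures on a Borel subset \<open>S\<close> are identified with Borel probability measures
  on the whole space giving full mass to \<open>S\<close>.\<close>

definition borel_prob_on :: "'a::topological_space set \<Rightarrow> 'a measure \<Rightarrow> bool" where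
  "borel_prob_on S \<mu> \<longleftrightarrow> prob_space \<mu> \<and> sets \<mu> = sets borel \<and> emeasure \<mu> S = 1"

definition causal_couplings ::
    "('a::topological_space \<Rightarrow> 'a \<Rightarrow> bool) \<Rightarrow> 'a measure \<Rightarrow> 'a measure \<Rightarrow> ('a \<times> 'a) measure set" where
  "causal_couplings caus \<mu>0 \<mu>1 = {\<pi>. prob_space \<pi> \<and> sets \<pi> = sets borel \<and>
     distr \<pi> borel fst = \<mu>0 \<and> distr \<pi> borel snd = \<mu>1 \<and>
     emeasure \<pi> {(x, y). caus x y} = 1}"

definition OptGeo ::
    "('a::metric_space \<Rightarrow> 'a \<Rightarrow> bool) \<Rightarrow> 'a set \<Rightarrow> ('a \<Rightarrow> real) \<Rightarrow> 'a measure \<Rightarrow> 'a measure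
       \<Rightarrow> (real \<Rightarrow> 'a) measure set" where
  "OptGeo caus H G \<mu>0 \<mu>1 = {\<nu>. prob_space \<nu> \<and>
     sets \<nu> = sets (borel_of_topology (mtopology_of (curve_space H))) \<and>
     distr \<nu> borel (\<lambda>\<gamma>. \<gamma> 0) = \<mu>0 \<and> distr \<nu> borel (\<lambda>\<gamma>. \<gamma> 1) = \<mu>1 \<and>
     emeasure \<nu> (Caus_G caus H G) = 1}"

end

theory Submission
  imports Defs
begin

text \<open>
  On \<open>H\<close> the causal relation is a partial order, because a gauge would have to increase strictly along
  an arc in both directions. Hence causal curves in \<open>H\<close> can be made injective, and the gauge
  reparametrises them to \<open>G\<close>-causal ones. Every inner point has a causal past in \<open>H\<close>, so
  non-branching shows that causally related inner points \<open>x \<le> y\<close> are joined by exactly one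
  \<open>G\<close>-causal curve \<open>geo (x, y)\<close>, whose image is the causal diamond of \<open>x\<close> and \<open>y\<close> in \<open>H\<close>.
  The diamonds are compact and depend on their endpoints with a closed graph; as \<open>X\<close> is
  \<open>\<sigma>\<close>-compact they admit a dense sequence of Borel selections, of which \<open>geo (x, y) t\<close> is a limit
  picked out by the Borel function \<open>G\<close>. Thus \<open>geo\<close> is Borel, the push-forward of \<open>\<pi>\<close> under \<open>geo\<close> is the
  required plan, and it is the only one since \<open>geo\<close> inverts \<open>(e\<^sub>0, e\<^sub>1)\<close> on \<open>G\<close>-causal curves.
\<close>

section \<open>Arcs in metric spaces\<close>

text \<open>Kuratowski embedding: subtracting the distance to \<open>x0\<close> keeps the distance
  function of \<open>x\<close> bounded, by \<open>dist x x0\<close>. Every metric space thus sits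
  isometrically in a Banach space.\<close>

lemma isometric_embedding_bcontfun:
  obtains \<phi> :: "'a::metric_space \<Rightarrow> 'a \<Rightarrow>\<^sub>C real" where "\<And>x y. dist (\<phi> x) (\<phi> y) = dist x y"
proof -
  fix x0 :: 'a
  define f where "f x z = dist x z - dist x0 z" for x z :: 'a
  have "f x \<in> bcontfun" for x
    unfolding f_def
    by (intro bcontfun_normI[where b = "dist x x0"] continuous_intros)
      (metis abs_dist_diff_le dist_commute real_norm_def)
  then have app: "apply_bcontfun (Bcontfun (f x)) = f x" for x
    by (rule Bcontfun_inverse)
  show thesis
  proof (rule that[of "\<lambda>x. Bcontfun (f x)"], rule antisym)
    fix x y
    show "dist (Bcontfun (f x)) (Bcontfun (f y)) \<le> dist x y"
      by (rule dist_bound)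
        (metis abs_dist_diff_le add_diff_cancel_left' app diff_diff_eq2 diff_add_cancel dist_commute dist_real_def f_def)
    \<comment> \<open>The sup distance is attained at the point \<open>y\<close>, where the two
      functions differ by exactly \<open>dist x y\<close>.\<close>
    have "dist (f x y) (f y y) \<le> dist (Bcontfun (f x)) (Bcontfun (f y))"
      by (metis app dist_bounded)
    then show "dist x y \<le> dist (Bcontfun (f x)) (Bcontfun (f y))"
      by (simp add: f_def dist_real_def)
  qed
qed

text \<open>The path is carried into the Banach space of bounded continuous functions, where
  \<open>path_contains_arc\<close> applies. The arc stays in the range of the embedding, so the
  inverse isometry brings it back.\<close>

lemma path_contains_arc_metric:
  fixes p :: "real \<Rightarrow> 'a::metric_space"
  assumes "path p" "pathstart p \<noteq> pathfinish p"
  obtains q where "arc q" "path_image q \<subseteq> path_image p"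
    "pathstart q = pathstart p" "pathfinish q = pathfinish p"
proof -
  obtain \<phi> :: "'a \<Rightarrow> 'a \<Rightarrow>\<^sub>C real" where \<phi>: "\<And>x y. dist (\<phi> x) (\<phi> y) = dist x y"
    using isometric_embedding_bcontfun by blast
  have inj: "inj \<phi>"
    by (metis \<phi> dist_eq_0_iff injI)
  have cont: "continuous_on UNIV \<phi>" "continuous_on (range \<phi>) (inv \<phi>)"
    using \<phi> inj by (auto simp: continuous_on_iff)
  have "path (\<phi> \<circ> p)"
    using assms(1) cont(1) by (simp add: path_continuous_image continuous_on_subset)
  moreover have "pathstart (\<phi> \<circ> p) \<noteq> pathfinish (\<phi> \<circ> p)"
    using assms(2) inj by (simp add: pathstart_compose pathfinish_compose inj_eq)
  ultimately obtain q where q: "arc q" "path_image q \<subseteq> path_image (\<phi> \<circ> p)"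
    "pathstart q = pathstart (\<phi> \<circ> p)" "pathfinish q = pathfinish (\<phi> \<circ> p)"
    using path_contains_arc by blast
  have range: "path_image q \<subseteq> range \<phi>"
    using q(2) by (auto simp: path_image_compose)
  show thesis
  proof (rule that[of "inv \<phi> \<circ> q"])
    show "arc (inv \<phi> \<circ> q)"
      using q(1) range cont(2)
      by (auto simp: arc_def path_image_def
          intro!: path_continuous_image comp_inj_on inj_on_subset[OF inj_on_inv_into]
          intro: continuous_on_subset)
    show "path_image (inv \<phi> \<circ> q) \<subseteq> path_image p"
      using q(2) inj by (force simp: path_image_compose)
    show "pathstart (inv \<phi> \<circ> q) = pathstart p" "pathfinish (inv \<phi> \<circ> q) = pathfinish p"
      using q(3,4) inj by (simp_all add: pathstart_compose pathfinish_compose)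
  qed
qed

text \<open>Both sets are preimages of the closed causal relation under continuous maps. They serve
  as the two pieces of a separation in \<open>arc_in_chain_monotone\<close>.\<close>

lemma closedin_caus_pairs:
  fixes q :: "real \<Rightarrow> 'a::metric_space"
  assumes cl: "closed {(x, y). caus x y}" and q: "continuous_on {0..1} q"
    and T: "T \<subseteq> {0..1} \<times> {0..1}"
  shows "closedin (top_of_set T) {p\<in>T. caus (q (fst p)) (q (snd p))}"
    "closedin (top_of_set T) {p\<in>T. caus (q (snd p)) (q (fst p))}"
proof -
  have c: "continuous_on T (\<lambda>p. q (fst p))" "continuous_on T (\<lambda>p. q (snd p))"
    using T by (auto intro!: continuous_on_compose2[OF q] continuous_intros)
  have "closedin (top_of_set T) (T \<inter> (\<lambda>p. (q (fst p), q (snd p))) -` {(x, y). caus x y})"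
    by (intro continuous_closedin_preimage continuous_intros c cl)
  then show "closedin (top_of_set T) {p\<in>T. caus (q (fst p)) (q (snd p))}"
    by (rule back_subst[where P="closedin _"]) auto
  have "closedin (top_of_set T) (T \<inter> (\<lambda>p. (q (snd p), q (fst p))) -` {(x, y). caus x y})"
    by (intro continuous_closedin_preimage continuous_intros c cl)
  then show "closedin (top_of_set T) {p\<in>T. caus (q (snd p)) (q (fst p))}"
    by (rule back_subst[where P="closedin _"]) auto
qed

text \<open>The set of pairs \<open>s < t\<close> is connected and is the disjoint union of the closed sets of pairs on
  which \<open>q\<close> preserves, respectively reverses, the order.\<close>

lemma arc_in_chain_monotone:
  fixes q :: "real \<Rightarrow> 'a::metric_space"
  assumes cl: "closed {(x, y). caus x y}"
    and q: "continuous_on {0..1} q" "inj_on q {0..1}"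
    and total: "\<And>x y. x \<in> q ` {0..1} \<Longrightarrow> y \<in> q ` {0..1} \<Longrightarrow> caus x y \<or> caus y x"
    and antisym: "\<And>x y. x \<in> q ` {0..1} \<Longrightarrow> y \<in> q ` {0..1} \<Longrightarrow> caus x y \<Longrightarrow> caus y x \<Longrightarrow> x = y"
    and "caus (q 0) (q 1)" and st: "s \<in> {0..1}" "t \<in> {0..1}" "s \<le> t"
  shows "caus (q s) (q t)"
proof (rule ccontr)
  assume neg: "\<not> caus (q s) (q t)"
  with st total have "s < t"
    by (metis imageI order_le_less)
  define T where "T = {p :: real \<times> real. 0 \<le> fst p \<and> snd p \<le> 1 \<and> fst p < snd p}"
  let ?A = "{p\<in>T. caus (q (fst p)) (q (snd p))}"
  let ?B = "{p\<in>T. caus (q (snd p)) (q (fst p))}"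
  have T: "T \<subseteq> {0..1} \<times> {0..1}"
    by (auto simp: T_def)
  have "convex T"
    unfolding convex_alt
  proof (intro ballI allI impI)
    fix x y :: "real \<times> real" and u :: real
    assume x: "x \<in> T" and y: "y \<in> T" and u: "0 \<le> u \<and> u \<le> 1"
    have "(1 - u) * (snd x - fst x) + u * (snd y - fst y) > 0"
    proof (cases "u = 0")
      case False
      then show ?thesis using x y u
        by (auto simp: T_def intro!: add_nonneg_pos)
    qed (use x in \<open>simp add: T_def\<close>)
    moreover have "(1 - u) * snd x + u * snd y \<le> 1"
      using x y u by (auto simp: T_def intro!: convex_bound_le)
    moreover have "0 \<le> (1 - u) * fst x + u * fst y"
      using x y u by (auto simp: T_def)
    ultimately show "(1 - u) *\<^sub>R x + u *\<^sub>R y \<in> T"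
      using x y u by (auto simp: T_def algebra_simps)
  qed
  then have "connected T" by (rule convex_connected)
  moreover have "T \<subseteq> ?A \<union> ?B"
  proof
    fix p assume "p \<in> T"
    then show "p \<in> ?A \<union> ?B"
      using total[of "q (fst p)" "q (snd p)"] T by auto
  qed
  moreover have "?A \<inter> ?B = {}"
  proof -
    have "False" if "p \<in> ?A" "p \<in> ?B" for p
    proof -
      have "q (fst p) = q (snd p)"
        using that T by (intro antisym) auto
      then have "fst p = snd p"
        using that T by (intro inj_onD[OF q(2)]) auto
      then show False using that by (simp add: T_def)
    qed
    then show ?thesis by blast
  qed
  \<comment> \<open>Both pieces are nonempty: one contains the pair of end times, the other the pair
    assumed to violate the claim.\<close>
  moreover have "(0, 1) \<in> ?A"
    using \<open>caus (q 0) (q 1)\<close> by (simp add: T_def)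
  moreover have "(s, t) \<in> ?B"
    using neg total[of "q s" "q t"] st \<open>s < t\<close> by (auto simp: T_def)
  ultimately show False
    using closedin_caus_pairs[OF cl q(1) T] connected_closedin[of T] by blast
qed

section \<open>Measurable selections\<close>

text \<open>Intersect with the complements of a countable basis, one after the other, as long as the result
  is nonempty. The complements separate points, so a single point survives.\<close>

lemma compact_valued_selection:
  fixes F :: "'b \<Rightarrow> 'a::polish_space set"
  assumes F: "\<And>x. x \<in> space M \<Longrightarrow> compact (F x)" "\<And>x. x \<in> space M \<Longrightarrow> F x \<noteq> {}"
    and hit: "\<And>K. closed K \<Longrightarrow> {x\<in>space M. F x \<inter> K \<noteq> {}} \<in> sets M"
  obtains f where "f \<in> borel_measurable M" "\<And>x. x \<in> space M \<Longrightarrow> f x \<in> F x"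
proof -
  obtain U :: "'a set set" where U: "countable U" "topological_basis U"
    using ex_countable_basis by blast
  have "U \<noteq> {}"
    using topological_basisE[OF U(2) open_UNIV UNIV_I] by blast
  define B where "B n = - from_nat_into U n" for n
  have B_closed: "closed (B n)" for n
    unfolding B_def using topological_basis_open[OF U(2)] from_nat_into[OF \<open>U \<noteq> {}\<close>]
    by (simp add: closed_Compl)
  have B_sep: "\<exists>n. p \<in> B n \<and> q \<notin> B n" if "p \<noteq> q" for p q
  proof -
    have "open (- {p})" "q \<in> - {p}"
      using that by auto
    then obtain V where "V \<in> U" "q \<in> V" "V \<subseteq> - {p}"
      by (rule topological_basisE[OF U(2)])
    then show ?thesis
      using from_nat_into_surj[OF U(1) \<open>V \<in> U\<close>] by (auto simp: B_def)
  qed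
  define R where
    "R = rec_nat F (\<lambda>n Fn x. if Fn x \<inter> B n \<noteq> {} then Fn x \<inter> B n else Fn x)"
  have R_0: "R 0 = F"
    and R_Suc: "R (Suc n) x = (if R n x \<inter> B n \<noteq> {} then R n x \<inter> B n else R n x)" for n x
    by (simp_all add: R_def)
  have R: "compact (R n x) \<and> R n x \<noteq> {}" if "x \<in> space M" for n x
    using that by (induction n) (auto simp: R_0 R_Suc F B_closed compact_Int_closed)
  have R_hit: "{x\<in>space M. R n x \<inter> K \<noteq> {}} \<in> sets M" if "closed K" for n K
    using that
  proof (induction n arbitrary: K)
    case 0
    then show ?case by (simp add: R_0 hit)
  next
    case (Suc n)
    let ?h = "\<lambda>K. {x\<in>space M. R n x \<inter> K \<noteq> {}}"
    have "{x\<in>space M. R (Suc n) x \<inter> K \<noteq> {}} =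
        (?h (B n) \<inter> ?h (B n \<inter> K)) \<union> (?h K - ?h (B n))"
      by (auto simp: R_Suc Int_assoc)
    moreover have "\<dots> \<in> sets M"
      using Suc.prems B_closed by (intro sets.Un sets.Int sets.Diff Suc.IH closed_Int)
    ultimately show ?case by simp
  qed
  have R_decseq: "R n x \<subseteq> R m x" if "m \<le> n" for m n x
    using that by (induction n rule: dec_induct) (auto simp: R_Suc)
  \<comment> \<open>Cantor's intersection theorem for the decreasing compact sets
    \<open>R n x\<close>; \<open>K\<close> is carried along because measurability of the selection
    needs more than nonemptiness.\<close>
  have nested: "(\<Inter>n. R n x \<inter> K) \<noteq> {}"
    if "x \<in> space M" "closed K" "\<And>n. R n x \<inter> K \<noteq> {}" for x K
  proof -
    have "R 0 x \<inter> (\<Inter>n\<in>UNIV. R n x \<inter> K) \<noteq> {}"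
    proof (rule compact_imp_fip_image)
      show "compact (R 0 x)" "\<And>n. n \<in> UNIV \<Longrightarrow> closed (R n x \<inter> K)"
        using R that(1,2) by (auto simp: compact_imp_closed)
      fix I :: "nat set" assume "finite I" "I \<subseteq> UNIV"
      then have "R (Max (insert 0 I)) x \<subseteq> R n x" if "n \<in> insert 0 I" for n
        using that by (intro R_decseq Max_ge) auto
      then have "R (Max (insert 0 I)) x \<inter> K \<subseteq> R 0 x \<inter> (\<Inter>n\<in>I. R n x \<inter> K)"
        by blast
      then show "R 0 x \<inter> (\<Inter>n\<in>I. R n x \<inter> K) \<noteq> {}"
        using that(3)[of "Max (insert 0 I)"] by blast
    qed
    then show ?thesis by auto
  qed
  \<comment> \<open>If both points survived, stage \<open>n\<close> would already have intersected
    with \<open>B n\<close>, since \<open>p\<close> lies in it, and so removed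
    \<open>q\<close>.\<close>
  have single: "p = q" if "\<And>n. p \<in> R n x" "\<And>n. q \<in> R n x" for p q x
  proof (rule ccontr)
    assume "p \<noteq> q"
    then obtain n where "p \<in> B n" "q \<notin> B n" using B_sep by blast
    then show False
      using that(1)[of n] that(2)[of "Suc n"] by (auto simp: R_Suc split: if_splits)
  qed
  define f where "f x = (SOME p. \<forall>n. p \<in> R n x)" for x
  have f: "f x \<in> R n x" if "x \<in> space M" for x n
  proof -
    have "\<exists>p. \<forall>n. p \<in> R n x"
      using nested[OF that closed_UNIV] R[OF that] by auto
    then have "\<forall>n. f x \<in> R n x"
      unfolding f_def by (rule someI_ex)
    then show ?thesis by blast
  qed
  show thesis
  proof (rule that)
    show "f x \<in> F x" if "x \<in> space M" for x
      using f[OF that, of 0] by (simp add: R_0)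
    have "f -` K \<inter> space M \<in> sets M" if K: "closed K" for K
    proof -
      \<comment> \<open>The sole survivor lies in \<open>K\<close> exactly when every stage meets
        \<open>K\<close>, which is a countable condition.\<close>
      have "f -` K \<inter> space M = (\<Inter>n. {x\<in>space M. R n x \<inter> K \<noteq> {}})"
      proof (intro equalityI subsetI)
        fix x assume "x \<in> (\<Inter>n. {x\<in>space M. R n x \<inter> K \<noteq> {}})"
        then have x: "x \<in> space M" "\<And>n. R n x \<inter> K \<noteq> {}" by auto
        then obtain p where "\<And>n. p \<in> R n x" "p \<in> K"
          using nested[OF x(1) K x(2)] by auto
        then show "x \<in> f -` K \<inter> space M"
          using single[of p x "f x"] f[OF x(1)] x(1) by auto
      qed (use f in auto)
      then show ?thesis
        using R_hit[OF K] by auto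
    qed
    then show "f \<in> borel_measurable M"
      unfolding borel_eq_closed by (intro measurable_measure_of) auto
  qed
qed

text \<open>The \<open>n\<close>-th selection is taken from \<open>F x \<inter> C n\<close> whenever
  this is nonempty, where \<open>C n\<close> is the closure of the \<open>n\<close>-th basic open
  set. Closures keep the values compact and the hitting sets measurable.\<close>

lemma compact_valued_dense_selections:
  fixes F :: "'b \<Rightarrow> 'a::polish_space set"
  assumes F: "\<And>x. x \<in> space M \<Longrightarrow> compact (F x)" "\<And>x. x \<in> space M \<Longrightarrow> F x \<noteq> {}"
    and hit: "\<And>K. closed K \<Longrightarrow> {x\<in>space M. F x \<inter> K \<noteq> {}} \<in> sets M"
  obtains z :: "nat \<Rightarrow> 'b \<Rightarrow> 'a" where "\<And>n. z n \<in> borel_measurable M"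
    "\<And>n x. x \<in> space M \<Longrightarrow> z n x \<in> F x"
    "\<And>x p e. x \<in> space M \<Longrightarrow> p \<in> F x \<Longrightarrow> e > 0 \<Longrightarrow> \<exists>n. dist (z n x) p < e"
proof -
  obtain U :: "'a set set" where U: "countable U" "topological_basis U"
    using ex_countable_basis by blast
  define C where "C n = closure (from_nat_into U n)" for n
  have "\<exists>f. f \<in> borel_measurable M \<and>
      (\<forall>x\<in>space M. f x \<in> F x \<and> (F x \<inter> C n \<noteq> {} \<longrightarrow> f x \<in> C n))" for n
  proof -
    define F' where "F' x = (if F x \<inter> C n \<noteq> {} then F x \<inter> C n else F x)" for x
    have C: "closed (C n)" by (simp add: C_def)
    have hit': "{x\<in>space M. F' x \<inter> K \<noteq> {}} \<in> sets M" if "closed K" for K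
    proof -
      let ?h = "\<lambda>K. {x\<in>space M. F x \<inter> K \<noteq> {}}"
      have "{x\<in>space M. F' x \<inter> K \<noteq> {}} = (?h (C n) \<inter> ?h (C n \<inter> K)) \<union> (?h K - ?h (C n))"
        by (auto simp: F'_def Int_assoc)
      also have "\<dots> \<in> sets M"
        using C that by (intro sets.Un sets.Int sets.Diff hit) auto
      finally show ?thesis .
    qed
    have F': "compact (F' x)" "F' x \<noteq> {}" if "x \<in> space M" for x
      using F[OF that] C by (auto simp: F'_def compact_Int_closed)
    show ?thesis
    proof (rule compact_valued_selection[OF F' hit'])
      fix f assume f: "f \<in> borel_measurable M" "\<And>x. x \<in> space M \<Longrightarrow> f x \<in> F' x"
      have "f x \<in> F x \<and> (F x \<inter> C n \<noteq> {} \<longrightarrow> f x \<in> C n)" if "x \<in> space M" for x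
        using f(2)[OF that] by (auto simp: F'_def split: if_splits)
      then show ?thesis
        using f(1) by blast
    qed
  qed
  then obtain z where z: "\<And>n. z n \<in> borel_measurable M"
    "\<And>n x. x \<in> space M \<Longrightarrow> z n x \<in> F x"
    "\<And>n x. x \<in> space M \<Longrightarrow> F x \<inter> C n \<noteq> {} \<Longrightarrow> z n x \<in> C n"
    by metis
  show thesis
  proof (rule that[OF z(1,2)])
    fix x p and e :: real
    assume x: "x \<in> space M" and p: "p \<in> F x" and "e > 0"
    \<comment> \<open>Half the radius, because the selected point lies only in the closure of the
      basic set.\<close>
    have "open (ball p (e/2))" "p \<in> ball p (e/2)"
      using \<open>e > 0\<close> by auto
    then obtain V where V: "V \<in> U" "p \<in> V" "V \<subseteq> ball p (e/2)"
      by (rule topological_basisE[OF U(2)])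
    then obtain n where n: "from_nat_into U n = V"
      using from_nat_into_surj[OF U(1)] by blast
    have "closure V \<subseteq> cball p (e/2)"
      using V(3) by (intro closure_minimal) (auto simp: subset_iff)
    moreover have "z n x \<in> closure V"
      using z(3)[OF x, of n] p V(2) closure_subset[of V] by (auto simp: C_def n)
    ultimately show "\<exists>n. dist (z n x) p < e"
      using \<open>e > 0\<close> by (intro exI[of _ n]) (force simp: dist_commute)
  qed
qed

text \<open>Projections of closed sets need not be closed, but \<sigma>-compactness makes this one a
  countable union of compact sets.\<close>

lemma fst_image_closed_borel:
  fixes S :: "('b::t2_space \<times> 'c::t2_space) set" and A :: "nat \<Rightarrow> ('b \<times> 'c) set"
  assumes "closed S" "\<And>n. compact (A n)" "(\<Union>n. A n) = UNIV"
  shows "fst ` S \<in> sets borel"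
proof -
  have "compact (fst ` (A n \<inter> S))" for n
    using assms by (intro compact_continuous_image compact_Int_closed continuous_intros) auto
  then have "(\<Union>n. fst ` (A n \<inter> S)) \<in> sets borel"
    by (intro sets.countable_UN) (auto simp: compact_imp_closed)
  moreover have "(\<Union>n. fst ` (A n \<inter> S)) = fst ` ((\<Union>n. A n) \<inter> S)"
    by blast
  ultimately show ?thesis
    using assms(3) by simp
qed

section \<open>Borel structure of the curve space\<close>

abbreviation curve_borel :: "'a::metric_space set \<Rightarrow> (real \<Rightarrow> 'a) measure" where
  "curve_borel H \<equiv> borel_of_topology (mtopology_of (curve_space H))"

text \<open>Compactness of the unit interval makes the boundedness condition in
  \<open>cfunspace\<close> automatic.\<close>

lemma mspace_curve_space:
  "mspace (curve_space H) = {\<gamma>\<in>extensional {0..1}. continuous_on {0..1} \<gamma> \<and> \<gamma> ` {0..1} \<subseteq> H}"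
proof -
  have "compactin (top_of_set {0..1::real}) (topspace (top_of_set {0..1}))"
    by (simp add: compactin_subtopology)
  note * = compactin_mspace_cfunspace[OF this, of "submetric euclidean_metric H"]
  show ?thesis
    unfolding curve_space_def *
    by (auto simp: mtopology_of_submetric continuous_map_in_subtopology)
qed

lemma mdist_curve_space_le:
  assumes "f \<in> mspace (curve_space H)" "g \<in> mspace (curve_space H)"
  shows "mdist (curve_space H) f g \<le> a \<longleftrightarrow> (\<forall>t\<in>{0..1}. dist (f t) (g t) \<le> a)"
  using assms cfunspace_mdist_le[of f "top_of_set {0..1}" "submetric euclidean_metric H" g a]
  by (simp add: curve_space_def)

lemma openin_curve_space:
  "openin (mtopology_of (curve_space H)) U \<longleftrightarrow> U \<subseteq> mspace (curve_space H) \<and>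
    (\<forall>f\<in>U. \<exists>r>0. \<forall>g\<in>mspace (curve_space H). mdist (curve_space H) f g < r \<longrightarrow> g \<in> U)"
proof -
  interpret Metric_space "mspace (curve_space H)" "mdist (curve_space H)" by simp
  have *: "mball f r \<subseteq> U \<longleftrightarrow>
      (\<forall>g\<in>mspace (curve_space H). mdist (curve_space H) f g < r \<longrightarrow> g \<in> U)"
    if "f \<in> mspace (curve_space H)" for f r
    using that by auto
  show ?thesis
    unfolding mtopology_of_def openin_mtopology using * by (meson subsetD)
qed

lemma space_curve_borel: "space (curve_borel H) = mspace (curve_space H)"
  by (simp add: borel_of_topology_def space_measure_of_conv)

lemma openin_in_sets_curve_borel:
  assumes "openin (mtopology_of (curve_space H)) U"
  shows "U \<in> sets (curve_borel H)"
proof -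
  have "{U. openin (mtopology_of (curve_space H)) U} \<subseteq> Pow (mspace (curve_space H))"
    using openin_subset by fastforce
  then show ?thesis
    using assms by (auto simp: borel_of_topology_def)
qed

text \<open>Evaluation is 1-Lipschitz for the sup distance, so preimages of open sets are
  open.\<close>

lemma measurable_eval [measurable]:
  assumes t: "t \<in> {0..1}"
  shows "(\<lambda>\<gamma>. \<gamma> t) \<in> borel_measurable (curve_borel H)"
proof (rule borel_measurableI)
  fix V :: "'a set" assume "open V"
  let ?U = "{\<gamma>\<in>mspace (curve_space H). \<gamma> t \<in> V}"
  have "openin (mtopology_of (curve_space H)) ?U"
    unfolding openin_curve_space
  proof (intro conjI ballI)
    fix f assume f: "f \<in> ?U"
    then obtain r where r: "r > 0" "ball (f t) r \<subseteq> V"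
      using \<open>open V\<close> open_contains_ball by blast
    have "g \<in> ?U" if "g \<in> mspace (curve_space H)" "mdist (curve_space H) f g < r" for g
    proof -
      have "dist (f t) (g t) \<le> mdist (curve_space H) f g"
        using mdist_curve_space_le[of f H g] f that t by blast
      then show ?thesis
        using that r(2) by auto
    qed
    then show "\<exists>r>0. \<forall>g\<in>mspace (curve_space H). mdist (curve_space H) f g < r \<longrightarrow> g \<in> ?U"
      using r(1) by blast
  qed auto
  moreover have "(\<lambda>\<gamma>. \<gamma> t) -` V \<inter> space (curve_borel H) = ?U"
    by (auto simp: space_curve_borel)
  ultimately show "(\<lambda>\<gamma>. \<gamma> t) -` V \<inter> space (curve_borel H) \<in> sets (curve_borel H)"
    by (simp add: openin_in_sets_curve_borel)
qed

lemma closure_rational_interval: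
  assumes "a < (b::real)"
  shows "closure (\<rat> \<inter> {a<..<b}) = {a..b}"
proof
  show "closure (\<rat> \<inter> {a<..<b}) \<subseteq> {a..b}"
    by (intro closure_minimal) auto
  have "{a<..<b} \<subseteq> closure (\<rat> \<inter> {a<..<b})"
    using open_Int_closure_subset[of "{a<..<b}" \<rat>] by (simp add: Rats_closure_real Int_commute)
  then have "closure {a<..<b} \<subseteq> closure (\<rat> \<inter> {a<..<b})"
    by (rule closure_minimal) simp
  then show "{a..b} \<subseteq> closure (\<rat> \<inter> {a<..<b})"
    using assms by simp
qed

text \<open>The sets \<open>W\<close> below are cylinder sets over countably many times; a countable number of them
  forms a network of the curve space.\<close>

lemma measurable_curve_borelI:
  fixes H :: "'a::polish_space set"
  assumes curve: "\<And>\<omega>. \<omega> \<in> space M \<Longrightarrow> \<Psi> \<omega> \<in> mspace (curve_space H)"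
    and eval: "\<And>t. t \<in> {0..1} \<Longrightarrow> (\<lambda>\<omega>. \<Psi> \<omega> t) \<in> borel_measurable M"
  shows "\<Psi> \<in> measurable M (curve_borel H)"
  unfolding borel_of_topology_def
proof (rule measurable_measure_of)
  show "{U. openin (mtopology_of (curve_space H)) U} \<subseteq> Pow (topspace (mtopology_of (curve_space H)))"
    using openin_subset by blast
  show "\<Psi> \<in> space M \<rightarrow> topspace (mtopology_of (curve_space H))"
    using curve by auto
  fix U assume "U \<in> {U. openin (mtopology_of (curve_space H)) U}"
  then have U: "U \<subseteq> mspace (curve_space H)"
    "\<And>f. f \<in> U \<Longrightarrow> \<exists>r>0. \<forall>g\<in>mspace (curve_space H). mdist (curve_space H) f g < r \<longrightarrow> g \<in> U"
    by (auto simp: openin_curve_space)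
  obtain Q :: "'a set" where Q: "countable Q" "\<And>X. open X \<Longrightarrow> X \<noteq> {} \<Longrightarrow> \<exists>d\<in>Q. d \<in> X"
    using countable_dense_exists by blast
  define T :: "real set" where "T = \<rat> \<inter> {0<..<1}"
  have T: "countable T" "T \<subseteq> {0..1}" "closure T = {0..1}"
    unfolding T_def by (auto simp: closure_rational_interval countable_rat)
  \<comment> \<open>A triple encodes a step function with values \<open>qs\<close> on a grid of mesh
    \<open>1 / n\<close>, and a tolerance. An index past the end of \<open>qs\<close> yields an
    unspecified point; this is harmless, since only \<open>W p \<subseteq> U\<close> and
    measurability matter.\<close>
  define W where "W = (\<lambda>(n::nat, qs::'a list, m::nat). {f\<in>mspace (curve_space H).
    \<forall>t\<in>T. dist (f t) (qs ! nat \<lfloor>real n * t\<rfloor>) \<le> 1 / Suc m})"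
  define P where "P = {p\<in>UNIV \<times> lists Q \<times> UNIV. W p \<subseteq> U}"
  have "countable P"
    unfolding P_def using Q(1)
    by (intro countable_subset[OF Collect_restrict] countable_SIGMA countable_lists) auto
  have preimage: "\<Psi> -` W p \<inter> space M \<in> sets M" for p
  proof -
    obtain n qs m where p: "p = (n, qs, m)" by (cases p)
    have "\<Psi> -` W p \<inter> space M =
        {\<omega>\<in>space M. \<forall>t\<in>T. dist (\<Psi> \<omega> t) (qs ! nat \<lfloor>real n * t\<rfloor>) \<le> 1 / Suc m}"
      using curve by (auto simp: W_def p)
    also have "\<dots> \<in> sets M"
    proof (rule sets.sets_Collect_countable_All'[OF _ T(1)])
      fix t assume "t \<in> T"
      then have [measurable]: "(\<lambda>\<omega>. \<Psi> \<omega> t) \<in> borel_measurable M"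
        using eval T(2) by blast
      show "{\<omega>\<in>space M. dist (\<Psi> \<omega> t) (qs ! nat \<lfloor>real n * t\<rfloor>) \<le> 1 / Suc m} \<in> sets M"
        by measurable
    qed
    finally show ?thesis .
  qed
  have "\<exists>p\<in>P. f \<in> W p" if f_U: "f \<in> U" for f
  proof -
    have f: "f \<in> mspace (curve_space H)" "continuous_on {0..1} f"
      using f_U U(1) by (auto simp: mspace_curve_space)
    obtain r where r: "r > 0" "\<And>g. g \<in> mspace (curve_space H) \<Longrightarrow> mdist (curve_space H) f g < r \<Longrightarrow> g \<in> U"
      using U(2)[OF f_U] by blast
    \<comment> \<open>Two members of one \<open>W p\<close> differ by at most
      \<open>2 / Suc m\<close>, which must stay below \<open>r\<close>.\<close>
    obtain m where m: "1 / Suc m < r / 2"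
      using nat_approx_posE[of "r/2"] r(1) by (auto simp: inverse_eq_divide)
    \<comment> \<open>Half the tolerance: the oscillation of \<open>f\<close> on a grid cell and the
      error of the approximating point in \<open>Q\<close> each cost less than
      \<open>e\<close>.\<close>
    define e :: real where "e = 1 / Suc m / 2"
    have "e > 0" by (simp add: e_def)
    have "uniformly_continuous_on {0..1} f"
      using f(2) by (intro compact_uniformly_continuous) auto
    then obtain d where d: "d > 0"
      "\<And>s t. s \<in> {0..1} \<Longrightarrow> t \<in> {0..1} \<Longrightarrow> dist s t < d \<Longrightarrow> dist (f s) (f t) < e"
      using \<open>e > 0\<close> unfolding uniformly_continuous_on_def by metis
    obtain n where n: "n > 0" "1 / real n < d"
      using ex_inverse_of_nat_less[OF d(1)] by (auto simp: inverse_eq_divide)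
    have "\<exists>q\<in>Q. dist (f (i / n)) q < e" for i :: nat
      using Q(2)[of "ball (f (i / n)) e"] \<open>e > 0\<close> by auto
    then obtain q where q: "\<And>i::nat. q i \<in> Q" "\<And>i::nat. dist (f (i / n)) (q i) < e"
      by metis
    define p where "p = (n, map q [0..<Suc n], m)"
    have W_p: "g \<in> W p \<longleftrightarrow> g \<in> mspace (curve_space H) \<and>
        (\<forall>t\<in>T. dist (g t) (q (nat \<lfloor>real n * t\<rfloor>)) \<le> 1 / Suc m)" for g
    proof -
      have "map q [0..<Suc n] ! nat \<lfloor>real n * t\<rfloor> = q (nat \<lfloor>real n * t\<rfloor>)" if "t \<in> T" for t
      proof -
        have "t \<le> 1"
          using that T(2) by auto
        then have "real n * t \<le> real n"
          using mult_left_mono[of t 1 "real n"] by simp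
        then have "nat \<lfloor>real n * t\<rfloor> < Suc n"
          by linarith
        then show ?thesis
          by (metis add_0 diff_zero length_upt nth_map nth_upt)
      qed
      then show ?thesis
        by (auto simp: W_def p_def simp del: upt_Suc)
    qed
    have "f \<in> W p"
      unfolding W_p
    proof (intro conjI ballI f(1))
      fix t assume "t \<in> T"
      then have t: "t \<in> {0..1}" using T(2) by blast
      define i where "i = nat \<lfloor>real n * t\<rfloor>"
      have i: "real i \<le> real n * t" "real n * t < real i + 1" "0 \<le> real i"
        using t by (auto simp: i_def)
      then have "real i / n \<le> t" "t < (real i + 1) / n"
        using n(1) by (auto simp: pos_divide_le_eq pos_less_divide_eq mult.commute)
      then have "dist (real i / n) t < d" "real i / n \<in> {0..1}"
        using n(2) t by (auto simp: dist_real_def add_divide_distrib)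
      then have "dist (f (real i / n)) (f t) < e"
        using d(2) t by blast
      then have "dist (f t) (q i) < e + e"
        using q(2)[of i] dist_triangle3[of "f t" "q i" "f (real i / n)"] by linarith
      then show "dist (f t) (q (nat \<lfloor>real n * t\<rfloor>)) \<le> 1 / Suc m"
        unfolding i_def e_def field_sum_of_halves by linarith
    qed
    moreover have "W p \<subseteq> U"
    proof
      fix g assume "g \<in> W p"
      then have g: "g \<in> mspace (curve_space H)" "continuous_on {0..1} g"
        by (auto simp: W_p mspace_curve_space)
      have on_T: "dist (f t) (g t) \<le> 2 / Suc m" if "t \<in> T" for t
      proof -
        have "dist (f t) (q (nat \<lfloor>real n * t\<rfloor>)) \<le> 1 / Suc m"
          "dist (g t) (q (nat \<lfloor>real n * t\<rfloor>)) \<le> 1 / Suc m"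
          using \<open>f \<in> W p\<close> \<open>g \<in> W p\<close> that by (auto simp: W_p)
        then show ?thesis
          using dist_triangle2[of "f t" "g t" "q (nat \<lfloor>real n * t\<rfloor>)"] by linarith
      qed
      \<comment> \<open>Continuity extends the bound from the dense set \<open>T\<close> of times to
        the whole interval.\<close>
      have "dist (f t) (g t) \<le> 2 / Suc m" if "t \<in> {0..1}" for t
        using continuous_le_on_closure[of T "\<lambda>t. dist (f t) (g t)" t "2 / Suc m"] on_T that f(2) g(2)
        by (auto simp: T(3) intro: continuous_on_dist)
      then have "mdist (curve_space H) f g \<le> 2 / Suc m"
        using mdist_curve_space_le[OF f(1) g(1)] by blast
      then show "g \<in> U"
        using m by (intro r(2) g(1)) auto
    qed
    moreover have "p \<in> UNIV \<times> lists Q \<times> UNIV"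
      using q(1) by (auto simp: p_def)
    ultimately show ?thesis
      by (auto simp: P_def)
  qed
  then have "U = (\<Union>p\<in>P. W p)"
    by (auto simp: P_def)
  then have "\<Psi> -` U \<inter> space M = (\<Union>p\<in>P. \<Psi> -` W p \<inter> space M)"
    by auto
  also have "\<dots> \<in> sets M"
    using \<open>countable P\<close> preimage by (intro sets.countable_UN'')
  finally show "\<Psi> -` U \<inter> space M \<in> sets M" .
qed

section \<open>Curves with affine gauge\<close>

locale gauged_achronal_set = topological_causal_space chron caus
  for chron caus :: "'a::polish_space \<Rightarrow> 'a \<Rightarrow> bool" +
  fixes H :: "'a set" and G :: "'a \<Rightarrow> real"
  assumes nonbranching: "forward_null_nonbranching caus H"
    and weakly_convex: "weakly_convex caus H"
    and closed_H: "closed H"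
    and gauge: "gauge_for caus H G"
begin

section \<open>The causal order on the set and its injective causal curves\<close>

abbreviation Hin :: "'a set" where "Hin \<equiv> inner_points caus H"

lemma caus_self [simp]: "caus x x"
  using caus_refl by (simp add: reflpD)

lemma caus_transitive: "caus x y \<Longrightarrow> caus y z \<Longrightarrow> caus x z"
  using caus_trans by (rule transpD)

lemma inner_iff:
  "z \<in> Hin \<longleftrightarrow> z \<in> H \<and> (\<exists>x\<in>H. caus x z \<and> x \<noteq> z) \<and> (\<exists>x\<in>H. caus z x \<and> x \<noteq> z)"
  by (auto simp: inner_points_def initial_points_def final_points_def)

lemma inner_subset: "z \<in> Hin \<Longrightarrow> z \<in> H"
  by (simp add: inner_iff)

text \<open>If \<open>z\<close> differs from both ends, then \<open>x\<close> and \<open>y\<close>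
  themselves witness that it is neither initial nor final.\<close>

lemma between_inner:
  assumes "x \<in> Hin" "y \<in> Hin" "z \<in> H" "caus x z" "caus z y"
  shows "z \<in> Hin"
proof (cases "z = x \<or> z = y")
  case False
  then show ?thesis
    using assms by (auto simp: inner_iff)
qed (use assms in auto)

lemma gauge_curve:
  assumes "causal_curve caus I Hin \<gamma>" "inj_on \<gamma> I"
  shows "strict_mono_on I (G \<circ> \<gamma>)" "continuous_on I (G \<circ> \<gamma>)"
  using gauge assms by (auto simp: gauge_for_def)

text \<open>If \<open>x \<le> y \<le> x\<close>, then any two points of a causal curve from \<open>x\<close> to \<open>y\<close> are related in both
  directions, so an arc in its image is causal in both directions and the gauge would have to be
  strictly increasing along both.\<close>

lemma caus_antisym:
  assumes "x \<in> H" "y \<in> H" "caus x y" "caus y x"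
  shows "x = y"
proof (rule ccontr)
  assume "x \<noteq> y"
  obtain \<gamma> where \<gamma>: "causal_curve caus {0..1} H \<gamma>" "\<gamma> 0 = x" "\<gamma> 1 = y"
    using weakly_convex assms by (auto simp: weakly_convex_def)
  have caus_x: "caus x z" "caus z x" "z \<in> H" if z: "z \<in> path_image \<gamma>" for z
  proof -
    obtain t where t: "t \<in> {0..1}" "z = \<gamma> t"
      using z unfolding path_image_def by blast
    have "caus (\<gamma> 0) (\<gamma> t)" "caus (\<gamma> t) (\<gamma> 1)" "\<gamma> t \<in> H"
      using \<gamma>(1) t(1) by (auto simp: causal_curve_def)
    then show "caus x z" "caus z x" "z \<in> H"
      using \<gamma>(2,3) t(2) caus_transitive[OF _ \<open>caus y x\<close>] by auto
  qed
  \<comment> \<open>Whichever of \<open>x\<close> and \<open>y\<close> differs from \<open>z\<close>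
    is related to \<open>z\<close> in both directions.\<close>
  have inner: "z \<in> Hin" if "z \<in> path_image \<gamma>" for z
    using caus_x[OF that] assms \<open>x \<noteq> y\<close> by (metis inner_iff caus_transitive)
  have related: "caus z w" if "z \<in> path_image \<gamma>" "w \<in> path_image \<gamma>" for z w
    using caus_x that caus_transitive by blast
  have "path \<gamma>" "pathstart \<gamma> \<noteq> pathfinish \<gamma>"
    using \<gamma> \<open>x \<noteq> y\<close> by (auto simp: causal_curve_def path_def pathstart_def pathfinish_def)
  then obtain q where q: "arc q" "path_image q \<subseteq> path_image \<gamma>"
    by (rule path_contains_arc_metric)
  have gauge_increasing: "G (p 0) < G (p 1)" if "arc p" "path_image p \<subseteq> path_image \<gamma>" for p
  proof -
    have "causal_curve caus {0..1} Hin p"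
      using that related inner
      by (auto simp: causal_curve_def arc_def path_def path_image_def is_interval_cc subset_iff)
    then have "strict_mono_on {0..1} (G \<circ> p)"
      using that gauge_curve(1) by (auto simp: arc_def)
    then show ?thesis
      using strict_mono_onD[of "{0..1}" "G \<circ> p" 0 1] by simp
  qed
  have "G (q 0) < G (q 1)" "G (reversepath q 0) < G (reversepath q 1)"
    using gauge_increasing q by (simp_all add: arc_reversepath)
  then show False
    by (simp add: reversepath_def)
qed

text \<open>An arc is extracted from the image of a connecting causal curve. That image is a chain,
  antisymmetric by \<open>caus_antisym\<close>, so \<open>arc_in_chain_monotone\<close> shows that
  the arc is again causal.\<close>

lemma causal_arc_exists:
  assumes "x \<in> H" "y \<in> H" "caus x y" "x \<noteq> y"
  obtains q where "causal_curve caus {0..1} H q" "inj_on q {0..1}" "q 0 = x" "q 1 = y"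
proof -
  obtain \<gamma> where \<gamma>: "causal_curve caus {0..1} H \<gamma>" "\<gamma> 0 = x" "\<gamma> 1 = y"
    using weakly_convex assms by (auto simp: weakly_convex_def)
  have "path \<gamma>" "pathstart \<gamma> \<noteq> pathfinish \<gamma>"
    using \<gamma> \<open>x \<noteq> y\<close> by (auto simp: causal_curve_def path_def pathstart_def pathfinish_def)
  then obtain q where q: "arc q" "path_image q \<subseteq> path_image \<gamma>"
    "pathstart q = pathstart \<gamma>" "pathfinish q = pathfinish \<gamma>"
    by (rule path_contains_arc_metric)
  have sub: "q ` {0..1} \<subseteq> \<gamma> ` {0..1}" "\<gamma> ` {0..1} \<subseteq> H"
    using q(2) \<gamma>(1) by (auto simp: path_image_def causal_curve_def)
  have cont: "continuous_on {0..1} q" "inj_on q {0..1}"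
    using q(1) by (auto simp: arc_def path_def)
  have ends: "q 0 = x" "q 1 = y"
    using q \<gamma> by (auto simp: pathstart_def pathfinish_def)
  have total: "caus z w \<or> caus w z" if z: "z \<in> q ` {0..1}" and w: "w \<in> q ` {0..1}" for z w
  proof -
    obtain s t where "z = \<gamma> s" "w = \<gamma> t" "s \<in> {0..1}" "t \<in> {0..1}"
      using z w sub by blast
    then show ?thesis
      using \<gamma>(1) linear[of s t] unfolding causal_curve_def by blast
  qed
  have antisym: "z = w" if "z \<in> q ` {0..1}" "w \<in> q ` {0..1}" "caus z w" "caus w z" for z w
    using that sub by (intro caus_antisym) auto
  have "caus (q s) (q t)" if "s \<in> {0..1}" "t \<in> {0..1}" "s \<le> t" for s t
    using arc_in_chain_monotone[of caus, OF closed_caus cont total antisym _ that] ends assms by simp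
  then have "causal_curve caus {0..1} H q"
    using sub cont by (auto simp: causal_curve_def is_interval_cc)
  then show thesis
    using that cont ends by blast
qed

lemma causal_curve_inner:
  assumes "causal_curve caus {0..1} H \<gamma>" "\<gamma> 0 \<in> Hin" "\<gamma> 1 \<in> Hin"
  shows "causal_curve caus {0..1} Hin \<gamma>"
proof -
  have "\<gamma> t \<in> Hin" if "t \<in> {0..1}" for t
  proof (rule between_inner[OF assms(2,3)])
    show "\<gamma> t \<in> H" "caus (\<gamma> 0) (\<gamma> t)" "caus (\<gamma> t) (\<gamma> 1)"
      using assms(1) that unfolding causal_curve_def by auto
  qed
  then show ?thesis
    using assms(1) unfolding causal_curve_def by blast
qed

text \<open>The gauge is compared at the two ends of a connecting causal arc, which stays among the
  inner points.\<close>

lemma gauge_less: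
  assumes "x \<in> Hin" "y \<in> Hin" "caus x y" "x \<noteq> y"
  shows "G x < G y"
proof -
  obtain q where q: "causal_curve caus {0..1} H q" "inj_on q {0..1}" "q 0 = x" "q 1 = y"
    using causal_arc_exists assms inner_subset by metis
  then have "strict_mono_on {0..1} (G \<circ> q)"
    using gauge_curve(1) causal_curve_inner assms by blast
  then show ?thesis
    using q strict_mono_onD[of "{0..1}" "G \<circ> q" 0 1] by simp
qed

lemma gauge_le: "x \<in> Hin \<Longrightarrow> y \<in> Hin \<Longrightarrow> caus x y \<Longrightarrow> G x \<le> G y"
  using gauge_less[of x y] by (cases "x = y") auto

text \<open>Injectivity survives because a point common to both arcs is both before and after the
  junction, hence equal to it by antisymmetry.\<close>

lemma join_causal_arcs:
  assumes p: "causal_curve caus {0..1} H p" "inj_on p {0..1}"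
    and q: "causal_curve caus {0..1} H q" "inj_on q {0..1}" and "p 1 = q 0"
  shows "causal_curve caus {0..1} H (p +++ q)" "inj_on (p +++ q) {0..1}"
proof -
  have cp: "caus (p s) (p t)" if "0 \<le> s" "s \<le> t" "t \<le> 1" for s t
    using p that by (auto simp: causal_curve_def)
  have cq: "caus (q s) (q t)" if "0 \<le> s" "s \<le> t" "t \<le> 1" for s t
    using q that by (auto simp: causal_curve_def)
  have sub: "p ` {0..1} \<subseteq> H" "q ` {0..1} \<subseteq> H"
    using p q by (auto simp: causal_curve_def)
  have "path (p +++ q)"
    using p q \<open>p 1 = q 0\<close>
    by (intro path_join_imp) (auto simp: causal_curve_def path_def pathstart_def pathfinish_def)
  moreover have "(p +++ q) ` {0..1} \<subseteq> H"
    using sub path_image_join_subset[of p q] unfolding path_image_def by blast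
  moreover have "caus ((p +++ q) s) ((p +++ q) t)" if "s \<in> {0..1}" "t \<in> {0..1}" "s \<le> t" for s t
    using that cp[of "2 * s" "2 * t"] cq[of "2 * s - 1" "2 * t - 1"] \<open>p 1 = q 0\<close>
      caus_transitive[of "p (2 * s)" "p 1" "q (2 * t - 1)"] cp[of "2 * s" 1] cq[of 0 "2 * t - 1"]
    by (simp add: joinpaths_def)
  ultimately show "causal_curve caus {0..1} H (p +++ q)"
    by (auto simp: causal_curve_def path_def is_interval_cc)
  have "arc (p +++ q)"
  proof (rule arc_join)
    show "arc p" "arc q"
      using p q by (auto simp: arc_def path_def causal_curve_def)
    show "pathfinish p = pathstart q"
      using \<open>p 1 = q 0\<close> by (simp add: pathstart_def pathfinish_def)
    show "path_image p \<inter> path_image q \<subseteq> {pathstart q}"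
    proof
      fix z assume "z \<in> path_image p \<inter> path_image q"
      then obtain s t where st: "s \<in> {0..1}" "t \<in> {0..1}" "z = p s" "z = q t"
        by (auto simp: path_image_def)
      then have "caus z (q 0)" "caus (q 0) z" "z \<in> H" "q 0 \<in> H"
        using cp[of s 1] cq[of 0 t] \<open>p 1 = q 0\<close> sub by auto
      then show "z \<in> {pathstart q}"
        using caus_antisym by (simp add: pathstart_def)
    qed
  qed
  then show "inj_on (p +++ q) {0..1}"
    by (simp add: arc_def)
qed

section \<open>Affinely gauged curves between inner points: existence, uniqueness, image\<close>

text \<open>Covers the constant and the nonconstant \<open>G\<close>-causal curves at once: the
  affine coefficients are fixed by the endpoint gauges and the formula includes the end times.
  Values off the unit interval are left free.\<close>

definition gcurve :: "'a \<Rightarrow> 'a \<Rightarrow> (real \<Rightarrow> 'a) \<Rightarrow> bool" where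
  "gcurve x y \<gamma> \<longleftrightarrow> causal_curve caus {0..1} Hin \<gamma> \<and> \<gamma> 0 = x \<and> \<gamma> 1 = y \<and>
     (\<forall>t\<in>{0..1}. G (\<gamma> t) = (1 - t) * G x + t * G y)"

lemma gcurve_const: "x \<in> Hin \<Longrightarrow> gcurve x x (\<lambda>_. x)"
  by (auto simp: gcurve_def causal_curve_def is_interval_cc algebra_simps)

lemma gcurveD:
  assumes "gcurve x y \<gamma>"
  shows "causal_curve caus {0..1} Hin \<gamma>" "\<gamma> 0 = x" "\<gamma> 1 = y"
    and "t \<in> {0..1} \<Longrightarrow> G (\<gamma> t) = (1 - t) * G x + t * G y"
  using assms unfolding gcurve_def by blast+

lemma gcurve_endpoints:
  assumes "gcurve x y \<gamma>"
  shows "x \<in> Hin" "y \<in> Hin" "caus x y"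
  using gcurveD(1-3)[OF assms] by (auto simp: causal_curve_def)

lemma gcurve_eq_const:
  assumes "gcurve x x \<gamma>" "t \<in> {0..1}"
  shows "\<gamma> t = x"
proof -
  have "caus (\<gamma> 0) (\<gamma> t)" "caus (\<gamma> t) (\<gamma> 1)" "\<gamma> t \<in> Hin"
    using gcurveD(1)[OF assms(1)] assms(2) unfolding causal_curve_def by auto
  then show ?thesis
    using caus_antisym inner_subset gcurveD(2,3)[OF assms(1)] gcurve_endpoints(1)[OF assms(1)] by metis
qed

text \<open>The affine function of time has the positive slope \<open>G y - G x\<close>, so the
  gauge value determines the time.\<close>

lemma gcurve_gauge_eq:
  assumes "gcurve x y \<gamma>" "x \<noteq> y" "s \<in> {0..1}" "t \<in> {0..1}" "G (\<gamma> s) = G (\<gamma> t)"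
  shows "s = t"
proof -
  have "G x < G y"
    using assms gcurve_endpoints gauge_less by blast
  moreover have "(1 - s) * G x + s * G y = (1 - t) * G x + t * G y"
    using assms gcurveD(4) by metis
  then have "(s - t) * (G y - G x) = 0"
    by (simp add: algebra_simps)
  ultimately show ?thesis by simp
qed

text \<open>Along an arc the gauge \<open>g\<close> is an increasing homeomorphism onto
  \<open>{g 0..g 1}\<close>. Following the affine map \<open>l\<close> by its inverse
  \<open>u\<close> gives the time change that makes the gauge affine.\<close>

lemma causal_arc_reparam:
  assumes q: "causal_curve caus {0..1} H q" "inj_on q {0..1}" and "q 0 \<in> Hin" "q 1 \<in> Hin"
  obtains \<gamma> where "gcurve (q 0) (q 1) \<gamma>" "\<gamma> ` {0..1} = q ` {0..1}"
proof -
  define g where "g = G \<circ> q"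
  have qi: "causal_curve caus {0..1} Hin q"
    using assms causal_curve_inner by blast
  have g: "strict_mono_on {0..1} g" "continuous_on {0..1} g"
    using gauge_curve[OF qi q(2)] by (auto simp: g_def)
  have inj: "inj_on g {0..1}"
    using g(1) strict_mono_on_imp_inj_on by blast
  define u where "u = the_inv_into {0..1} g"
  have u: "u (g s) = s" if "s \<in> {0..1}" for s
    using the_inv_into_f_f[OF inj that] by (simp add: u_def)
  define l where "l t = (1 - t) * g 0 + t * g 1" for t
  have l_alt: "l t = g 0 + t * (g 1 - g 0)" for t
    by (simp add: l_def algebra_simps)
  have g01: "g 0 < g 1"
    using strict_mono_onD[OF g(1), of 0 1] by simp
  have img: "g ` {0..1} = {g 0..g 1}"
  proof (intro equalityI subsetI)
    fix c assume "c \<in> {g 0..g 1}"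
    then show "c \<in> g ` {0..1}"
      using IVT'[of g 0 c 1] g(2) by auto
  next
    fix c assume "c \<in> g ` {0..1}"
    then show "c \<in> {g 0..g 1}"
      using strict_mono_on_leD[OF g(1)] by auto
  qed
  have l: "l ` {0..1} = {g 0..g 1}"
  proof (intro equalityI subsetI)
    fix c assume "c \<in> l ` {0..1}"
    then obtain t where t: "t \<in> {0..1}" "c = l t" by blast
    then have "c = g 0 + t * (g 1 - g 0)"
      by (simp add: l_alt)
    moreover have "0 \<le> t * (g 1 - g 0)" "t * (g 1 - g 0) \<le> 1 * (g 1 - g 0)"
      using g01 t by (auto intro!: mult_right_mono)
    ultimately show "c \<in> {g 0..g 1}" by auto
  next
    fix c assume c: "c \<in> {g 0..g 1}"
    then have "c = l ((c - g 0) / (g 1 - g 0))" "(c - g 0) / (g 1 - g 0) \<in> {0..1}"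
      using g01 by (auto simp: l_alt)
    then show "c \<in> l ` {0..1}" by blast
  qed
  have l_mono: "l s \<le> l t" if "s \<le> t" for s t
  proof -
    have "l t - l s = (t - s) * (g 1 - g 0)"
      by (simp add: l_alt algebra_simps)
    then show ?thesis
      using that g01 by (metis diff_ge_0_iff_ge less_imp_le mult_nonneg_nonneg)
  qed
  have u_g: "u c \<in> {0..1}" "g (u c) = c" if "c \<in> {g 0..g 1}" for c
    using that u unfolding img[symmetric] by auto
  have u_mono: "u c \<le> u d" if "c \<in> {g 0..g 1}" "d \<in> {g 0..g 1}" "c \<le> d" for c d
    using u_g[OF that(1)] u_g[OF that(2)] strict_mono_onD[OF g(1), of "u d" "u c"] that(3)
    by (metis leD leI)
  have u_img: "u ` {g 0..g 1} = {0..1}"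
    using u u_g(1) by (force simp: image_image img[symmetric])
  have u_cont: "continuous_on {g 0..g 1} u"
    unfolding img[symmetric] using u by (intro continuous_on_inv g(2)) auto
  have l_cont: "continuous_on {0..1} l"
    unfolding l_def by (intro continuous_intros)
  define \<gamma> where "\<gamma> = q \<circ> (u \<circ> l)"
  have image: "\<gamma> ` {0..1} = q ` {0..1}"
    by (simp only: \<gamma>_def image_comp[symmetric] l u_img)
  have lt: "l t \<in> {g 0..g 1}" if "t \<in> {0..1}" for t
    using l that by blast
  have "continuous_on {0..1} \<gamma>"
    unfolding \<gamma>_def
    by (intro continuous_on_compose; simp only: image_comp[symmetric] l u_img l_cont u_cont)
      (use qi in \<open>simp add: causal_curve_def\<close>)
  moreover have "caus (\<gamma> s) (\<gamma> t)" if "s \<in> {0..1}" "t \<in> {0..1}" "s \<le> t" for s t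
    using that qi u_mono[OF lt lt l_mono] u_g(1)[OF lt] by (auto simp: \<gamma>_def causal_curve_def)
  ultimately have "causal_curve caus {0..1} Hin \<gamma>"
    using image qi by (auto simp: causal_curve_def is_interval_cc)
  moreover have "\<gamma> 0 = q 0" "\<gamma> 1 = q 1"
    using u by (auto simp: \<gamma>_def l_def)
  moreover have "G (\<gamma> t) = (1 - t) * G (q 0) + t * G (q 1)" if "t \<in> {0..1}" for t
    using u_g(2)[OF lt[OF that]] by (simp add: \<gamma>_def g_def l_def)
  ultimately show thesis
    using image that[of \<gamma>] unfolding gcurve_def by blast
qed

lemma gcurve_exists:
  assumes "x \<in> Hin" "y \<in> Hin" "caus x y"
  obtains \<gamma> where "gcurve x y \<gamma>"
proof (cases "x = y")
  case True
  then show ?thesis using gcurve_const assms that by blast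
next
  case False
  then obtain q where "causal_curve caus {0..1} H q" "inj_on q {0..1}" "q 0 = x" "q 1 = y"
    using causal_arc_exists assms inner_subset by metis
  then show ?thesis
    using causal_arc_reparam assms that by metis
qed

lemma gcurve_arc:
  assumes "gcurve x y \<gamma>" "x \<noteq> y"
  shows "causal_curve caus {0..1} H \<gamma>" "inj_on \<gamma> {0..1}"
proof -
  show "causal_curve caus {0..1} H \<gamma>"
    using gcurveD(1)[OF assms(1)] inner_subset by (auto simp: causal_curve_def)
  show "inj_on \<gamma> {0..1}"
    using gcurve_gauge_eq[OF assms] by (auto intro!: inj_onI)
qed

text \<open>Since \<open>x\<close> is not initial, both curves can be prolonged to the past of \<open>x\<close> by the same arc, and
  non-branching applies to the prolonged curves.\<close>

lemma gcurve_unique: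
  assumes 1: "gcurve x y \<gamma>1" and 2: "gcurve x y \<gamma>2" and t: "t \<in> {0..1}"
  shows "\<gamma>1 t = \<gamma>2 t"
proof (cases "x = y")
  case True
  then show ?thesis
    using gcurve_eq_const[of x \<gamma>1 t] gcurve_eq_const[of x \<gamma>2 t] assms by simp
next
  case False
  obtain w where w: "w \<in> H" "caus w x" "w \<noteq> x"
    using gcurve_endpoints(1)[OF 1] unfolding inner_iff by blast
  have "x \<in> H" using gcurve_endpoints[OF 1] inner_subset by blast
  obtain p where p: "causal_curve caus {0..1} H p" "inj_on p {0..1}" "p 0 = w" "p 1 = x"
    using causal_arc_exists[OF w(1) \<open>x \<in> H\<close> w(2,3)] by blast
  have ends: "\<gamma>1 0 = x" "\<gamma>2 0 = x"
    using 1 2 gcurveD by blast+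
  have image: "(p +++ \<gamma>) ` {0..1} = p ` {0..1} \<union> \<gamma> ` {0..1}" if "\<gamma> 0 = x" for \<gamma>
    using path_image_join[of p \<gamma>] that p by (simp add: pathstart_def pathfinish_def path_image_def)
  \<comment> \<open>A point of the first curve lying on the prolongation \<open>p\<close> is both
    before and after \<open>x\<close>, hence is \<open>x\<close>. So every point lies on the second
    curve, and equality of gauges identifies its time there.\<close>
  have nested: "\<gamma> s = \<gamma>' s"
    if s: "s \<in> {0..1}" and \<gamma>: "gcurve x y \<gamma>" and \<gamma>': "gcurve x y \<gamma>'"
      and sub: "(p +++ \<gamma>) ` {0..1} \<subseteq> (p +++ \<gamma>') ` {0..1}" for \<gamma> \<gamma>' s
  proof -
    have start: "\<gamma> 0 = x" "\<gamma>' 0 = x"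
      using \<gamma> \<gamma>' gcurveD by blast+
    have "\<gamma> s \<in> \<gamma>' ` {0..1}"
    proof (rule ccontr)
      assume notin: "\<gamma> s \<notin> \<gamma>' ` {0..1}"
      have "\<gamma> s \<in> p ` {0..1} \<union> \<gamma>' ` {0..1}"
        using sub s unfolding image[of \<gamma>, OF start(1)] image[of \<gamma>', OF start(2)] by blast
      with notin obtain r where r: "r \<in> {0..1}" "\<gamma> s = p r"
        by blast
      have "caus (p r) (p 1)"
        using p(1) r(1) unfolding causal_curve_def by simp
      moreover have "caus (\<gamma> 0) (\<gamma> s)" "\<gamma> s \<in> H"
        using gcurve_arc(1)[OF \<gamma> False] s unfolding causal_curve_def by auto
      ultimately have "caus (\<gamma> s) x" "caus x (\<gamma> s)" "\<gamma> s \<in> H"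
        using r(2) start(1) p(4) by auto
      then have "\<gamma> s = x"
        using caus_antisym \<open>x \<in> H\<close> by blast
      then show False
        using notin start(2) by force
    qed
    then obtain r where r: "r \<in> {0..1}" "\<gamma> s = \<gamma>' r" by blast
    have "G (\<gamma>' s) = G (\<gamma>' r)"
      using r(2) gcurveD(4)[OF \<gamma> s] gcurveD(4)[OF \<gamma>' s] by simp
    then have "s = r"
      by (rule gcurve_gauge_eq[OF \<gamma>' False s r(1)])
    then show ?thesis
      using r(2) by simp
  qed
  \<comment> \<open>Joined paths run through \<open>p\<close> during the first half, so they agree
    at \<open>0\<close> and \<open>1/2\<close>, the two times in the non-branching
    condition.\<close>
  have "(p +++ \<gamma>1) 0 = (p +++ \<gamma>2) 0" "(p +++ \<gamma>1) (1/2) = (p +++ \<gamma>2) (1/2)"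
    by (auto simp: joinpaths_def)
  then have "(p +++ \<gamma>1) ` {0..1} \<subseteq> (p +++ \<gamma>2) ` {0..1} \<or>
      (p +++ \<gamma>2) ` {0..1} \<subseteq> (p +++ \<gamma>1) ` {0..1}"
    using nonbranching[unfolded forward_null_nonbranching_def, rule_format, of "p +++ \<gamma>1" "p +++ \<gamma>2"]
      join_causal_arcs[OF p(1,2) gcurve_arc[OF 1 False]]
      join_causal_arcs[OF p(1,2) gcurve_arc[OF 2 False]] ends p(4) by simp
  then show ?thesis
  proof
    assume "(p +++ \<gamma>1) ` {0..1} \<subseteq> (p +++ \<gamma>2) ` {0..1}"
    then show ?thesis by (rule nested[OF t 1 2])
  next
    assume "(p +++ \<gamma>2) ` {0..1} \<subseteq> (p +++ \<gamma>1) ` {0..1}"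
    then show ?thesis by (rule nested[OF t 2 1, symmetric])
  qed
qed

text \<open>Through any intermediate \<open>z\<close> runs a joined arc from \<open>x\<close> to
  \<open>y\<close>; reparametrised by the gauge, it must be the given curve by uniqueness. The image
  is thereby described by the order alone, which is what measurability rests on.\<close>

lemma gcurve_image:
  assumes \<gamma>: "gcurve x y \<gamma>"
  shows "\<gamma> ` {0..1} = {z\<in>H. caus x z \<and> caus z y}"
proof (intro equalityI subsetI)
  fix z assume "z \<in> \<gamma> ` {0..1}"
  then obtain t where t: "t \<in> {0..1}" "z = \<gamma> t" by blast
  have "caus (\<gamma> 0) (\<gamma> t)" "caus (\<gamma> t) (\<gamma> 1)" "\<gamma> t \<in> Hin"
    using gcurveD(1)[OF \<gamma>] t(1) unfolding causal_curve_def by auto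
  then show "z \<in> {z\<in>H. caus x z \<and> caus z y}"
    using gcurveD(2,3)[OF \<gamma>] inner_subset t(2) by simp
next
  fix z assume "z \<in> {z\<in>H. caus x z \<and> caus z y}"
  then have z: "z \<in> H" "caus x z" "caus z y" by auto
  have ends: "\<gamma> 0 = x" "\<gamma> 1 = y"
    using \<gamma> gcurveD by blast+
  show "z \<in> \<gamma> ` {0..1}"
  proof (cases "z = x \<or> z = y")
    case True
    then show ?thesis
      unfolding ends[symmetric] by auto
  next
    case False
    have "x \<in> H" "y \<in> H"
      using gcurve_endpoints[OF \<gamma>] inner_subset by auto
    obtain p where p: "causal_curve caus {0..1} H p" "inj_on p {0..1}" "p 0 = x" "p 1 = z"
      using causal_arc_exists[of x z] \<open>x \<in> H\<close> z False by metis
    obtain q where q: "causal_curve caus {0..1} H q" "inj_on q {0..1}" "q 0 = z" "q 1 = y"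
      using causal_arc_exists[of z y] \<open>y \<in> H\<close> z False by metis
    have "p 1 = q 0" using p q by simp
    note join = join_causal_arcs[OF p(1,2) q(1,2) this]
    have pq: "(p +++ q) 0 = x" "(p +++ q) 1 = y" "(p +++ q) (1/2) = z"
      using p q by (auto simp: joinpaths_def)
    obtain \<gamma>' where \<gamma>': "gcurve x y \<gamma>'" "\<gamma>' ` {0..1} = (p +++ q) ` {0..1}"
      using causal_arc_reparam[OF join] pq gcurve_endpoints[OF \<gamma>] by metis
    have "z \<in> (p +++ q) ` {0..1}"
      using pq(3) by (intro image_eqI[of _ _ "1/2"]) auto
    moreover have "\<gamma>' ` {0..1} = \<gamma> ` {0..1}"
      by (intro image_cong refl gcurve_unique[OF \<gamma>'(1) \<gamma>])
    ultimately show ?thesis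
      using \<gamma>'(2) by simp
  qed
qed

lemma gcurve_restrict:
  assumes "gcurve x y \<gamma>"
  shows "gcurve x y (restrict \<gamma> {0..1})"
proof -
  have "continuous_on {0..1} \<gamma>"
    using gcurveD(1)[OF assms] unfolding causal_curve_def by blast
  then have "continuous_on {0..1} (restrict \<gamma> {0..1})"
    by (rule continuous_on_eq) simp
  then have "causal_curve caus {0..1} Hin (restrict \<gamma> {0..1})"
    using gcurveD(1)[OF assms] unfolding causal_curve_def by simp
  then show ?thesis
    using gcurveD(2-)[OF assms] unfolding gcurve_def by simp
qed

text \<open>Affinity is given only at interior times, and \<open>G\<close> need not be continuous. A
  nonconstant curve has positive slope, hence is injective; then the gauge is continuous along it
  and the affine formula reaches the end times.\<close>

lemma Caus_G_gcurve:
  assumes "\<gamma> \<in> Caus_G caus H G" "\<gamma> 0 \<in> Hin" "\<gamma> 1 \<in> Hin"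
  shows "gcurve (\<gamma> 0) (\<gamma> 1) \<gamma>"
proof (cases "\<exists>x. \<forall>t\<in>{0..1}. \<gamma> t = x")
  case True
  then obtain x where x: "\<And>t. t \<in> {0..1} \<Longrightarrow> \<gamma> t = x" by blast
  have "x \<in> Hin" using assms(2) x[of 0] by simp
  then have "gcurve x x (restrict (\<lambda>_. x) {0..1})"
    by (intro gcurve_restrict gcurve_const)
  moreover have "\<gamma> \<in> extensional {0..1}"
    using assms(1) by (auto simp: Caus_G_def mspace_curve_space)
  then have "\<gamma> = restrict (\<lambda>_. x) {0..1}"
    using x by (auto intro!: extensionalityI[of _ "{0..1}"])
  ultimately show ?thesis
    using x[of 0] x[of 1] by simp
next
  case False
  then obtain a b where curve: "causal_curve caus {0..1} H \<gamma>"
    and ab: "\<And>t. t \<in> {0<..<1} \<Longrightarrow> G (\<gamma> t) = a * t + b"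
    using assms(1) unfolding Caus_G_def by blast
  have inner: "causal_curve caus {0..1} Hin \<gamma>"
    using curve assms(2,3) by (rule causal_curve_inner)
  have cont: "continuous_on {0..1} \<gamma>"
    and caus: "\<And>s t. 0 \<le> s \<Longrightarrow> s \<le> t \<Longrightarrow> t \<le> 1 \<Longrightarrow> caus (\<gamma> s) (\<gamma> t)"
    and Hin: "\<And>t. 0 \<le> t \<Longrightarrow> t \<le> 1 \<Longrightarrow> \<gamma> t \<in> Hin"
    using inner unfolding causal_curve_def by auto
  have closure: "closure {0<..<1::real} = {0..1}"
    by simp
  \<comment> \<open>With nonpositive slope, \<open>gauge_less\<close> rules out two distinct values
    at interior times, so the curve would be constant.\<close>
  have "a > 0"
  proof (rule ccontr)
    assume "\<not> a > 0"
    have const: "\<gamma> s = \<gamma> t" if "0 < s" "s < t" "t < 1" for s t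
    proof (rule ccontr)
      assume "\<gamma> s \<noteq> \<gamma> t"
      then have "G (\<gamma> s) < G (\<gamma> t)"
        using that by (intro gauge_less Hin caus) auto
      then have "a * (t - s) > 0"
        using that by (simp add: ab algebra_simps)
      then show False
        using \<open>\<not> a > 0\<close> that by (simp add: zero_less_mult_iff)
    qed
    have "\<gamma> t = \<gamma> (1/2)" if "t \<in> {0<..<1}" for t
    proof (cases t "1/2::real" rule: linorder_cases)
      case less
      then show ?thesis using that by (intro const) auto
    next
      case equal
      then show ?thesis by (rule arg_cong)
    next
      case greater
      then show ?thesis using that by (intro const[symmetric]) auto
    qed
    then have "\<gamma> t = \<gamma> (1/2)" if "t \<in> {0..1}" for t
      using continuous_constant_on_closure[of "{0<..<1}" \<gamma> "\<gamma> (1/2)" t] cont that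
      unfolding closure by blast
    then show False
      using False by blast
  qed
  have inj_less: "\<gamma> s \<noteq> \<gamma> t" if st: "0 \<le> s" "s < t" "t \<le> 1" for s t
  proof
    assume eq: "\<gamma> s = \<gamma> t"
    have const: "\<gamma> r = \<gamma> s" if "s \<le> r" "r \<le> t" for r
    proof (rule caus_antisym)
      show "caus (\<gamma> r) (\<gamma> s)"
        unfolding eq using that st by (intro caus) auto
    qed (use that st in \<open>auto intro!: caus Hin inner_subset\<close>)
    \<comment> \<open>Equal values at \<open>s\<close> and \<open>t\<close> force constancy between
      them. The times \<open>u\<close> and \<open>v\<close> are strictly inside, so the affine
      formula holds there even if \<open>s\<close> or \<open>t\<close> is an end time.\<close>
    define u v where "u = s + (t - s) / 3" and "v = s + (t - s) / 2"
    have uv: "s < u" "u < v" "v < t"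
      using st by (auto simp: u_def v_def field_simps)
    then have "G (\<gamma> u) = G (\<gamma> v)"
      using const[of u] const[of v] by simp
    then have "a * u = a * v"
      using ab[of u] ab[of v] uv st by simp
    then show False
      using \<open>a > 0\<close> uv by simp
  qed
  have "inj_on \<gamma> {0..1}"
  proof (rule inj_onI)
    fix s t :: real assume "s \<in> {0..1}" "t \<in> {0..1}" "\<gamma> s = \<gamma> t"
    then show "s = t"
      using inj_less[of s t] inj_less[of t s] by (cases s t rule: linorder_cases) auto
  qed
  then have "continuous_on {0..1} (\<lambda>t. G (\<gamma> t) - (a * t + b))"
    using gauge_curve(2)[OF inner] by (intro continuous_intros) (simp add: comp_def)
  then have G: "G (\<gamma> t) - (a * t + b) = 0" if "t \<in> {0..1}" for t
    using continuous_constant_on_closure[of "{0<..<1}" "\<lambda>t. G (\<gamma> t) - (a * t + b)" 0 t] that ab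
    unfolding closure by simp
  have "G (\<gamma> t) = (1 - t) * G (\<gamma> 0) + t * G (\<gamma> 1)" if "t \<in> {0..1}" for t
    using G[OF that] G[of 0] G[of 1] by (simp add: algebra_simps)
  then show ?thesis
    using inner unfolding gcurve_def by blast
qed

section \<open>The connecting curve as a function of its endpoints\<close>

definition causal_pairs :: "('a \<times> 'a) set" where
  "causal_pairs = {(x, y). x \<in> Hin \<and> y \<in> Hin \<and> caus x y}"

text \<open>The restriction makes the chosen curve an element of the curve space, whose members are
  \<open>undefined\<close> off \<open>{0..1}\<close>.\<close>

definition geo :: "'a \<times> 'a \<Rightarrow> real \<Rightarrow> 'a" where
  "geo p = restrict (SOME \<gamma>. gcurve (fst p) (snd p) \<gamma>) {0..1}"

lemma gcurve_geo:
  assumes "p \<in> causal_pairs"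
  shows "gcurve (fst p) (snd p) (geo p)"
proof -
  have "fst p \<in> Hin" "snd p \<in> Hin" "caus (fst p) (snd p)"
    using assms by (auto simp: causal_pairs_def)
  then have "\<exists>\<gamma>. gcurve (fst p) (snd p) \<gamma>"
    by (rule gcurve_exists) (rule exI)
  then have "gcurve (fst p) (snd p) (SOME \<gamma>. gcurve (fst p) (snd p) \<gamma>)"
    by (rule someI_ex)
  then show ?thesis
    unfolding geo_def by (rule gcurve_restrict)
qed

lemma geo_in_mspace:
  assumes "p \<in> causal_pairs"
  shows "geo p \<in> mspace (curve_space H)"
proof -
  have "geo p \<in> extensional {0..1}"
    by (simp add: geo_def)
  then show ?thesis
    using gcurveD(1)[OF gcurve_geo[OF assms]] inner_subset
    unfolding mspace_curve_space causal_curve_def by blast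
qed

lemma geo_in_Caus_G:
  assumes "p \<in> causal_pairs"
  shows "geo p \<in> Caus_G caus H G"
proof -
  note \<gamma> = gcurve_geo[OF assms]
  have "\<forall>t\<in>{0<..<1}. G (geo p t) = (G (snd p) - G (fst p)) * t + G (fst p)"
    using gcurveD(4)[OF \<gamma>] by (simp add: algebra_simps)
  moreover have "causal_curve caus {0..1} H (geo p)" "geo p ` {0<..<1} \<subseteq> Hin"
    using gcurveD(1)[OF \<gamma>] inner_subset unfolding causal_curve_def by auto
  ultimately show ?thesis
    using geo_in_mspace[OF assms] unfolding Caus_G_def by blast
qed

lemma Caus_G_eq_geo:
  assumes "\<gamma> \<in> Caus_G caus H G" "(\<gamma> 0, \<gamma> 1) \<in> causal_pairs"
  shows "geo (\<gamma> 0, \<gamma> 1) = \<gamma>"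
proof (rule extensionalityI[of _ "{0..1}"])
  show "geo (\<gamma> 0, \<gamma> 1) \<in> extensional {0..1}"
    by (simp add: geo_def)
  show "\<gamma> \<in> extensional {0..1}"
    using assms(1) by (auto simp: Caus_G_def mspace_curve_space)
  have "gcurve (\<gamma> 0) (\<gamma> 1) \<gamma>"
    using assms by (intro Caus_G_gcurve) (auto simp: causal_pairs_def)
  then show "geo (\<gamma> 0, \<gamma> 1) t = \<gamma> t" if "t \<in> {0..1}" for t
    using gcurve_unique gcurve_geo[OF assms(2)] that by simp
qed

section \<open>Measurability of the connecting curve\<close>

lemma geo_image:
  assumes "p \<in> causal_pairs"
  shows "geo p ` {0..1} = {z\<in>H. caus (fst p) z \<and> caus z (snd p)}"
  using gcurve_image[OF gcurve_geo[OF assms]] .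

text \<open>The gauge is only Borel in general. On the image of a nonconstant curve it is an affine
  function of time, and time depends continuously on the point, as the inverse of a continuous
  injection on a compact interval.\<close>

lemma gauge_on_gcurve:
  assumes \<gamma>: "gcurve x y \<gamma>"
  shows "continuous_on (\<gamma> ` {0..1}) G" "inj_on G (\<gamma> ` {0..1})"
proof -
  have cont: "continuous_on {0..1} \<gamma>"
    and caus: "\<And>s t. 0 \<le> s \<Longrightarrow> s \<le> t \<Longrightarrow> t \<le> 1 \<Longrightarrow> caus (\<gamma> s) (\<gamma> t)"
    and Hin: "\<And>t. 0 \<le> t \<Longrightarrow> t \<le> 1 \<Longrightarrow> \<gamma> t \<in> Hin"
    using gcurveD(1)[OF \<gamma>] unfolding causal_curve_def by auto
  show "continuous_on (\<gamma> ` {0..1}) G"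
  proof (cases "x = y")
    case True
    then have "\<gamma> ` {0..1} \<subseteq> {x}"
      using gcurve_eq_const[of x \<gamma>] \<gamma> by blast
    then show ?thesis
      by (rule continuous_on_subset[rotated]) simp
  next
    case False
    define h where "h = the_inv_into {0..1} \<gamma>"
    have h: "h (\<gamma> t) = t" if "t \<in> {0..1}" for t
      unfolding h_def using gcurve_arc(2)[OF \<gamma> False] that by (rule the_inv_into_f_f)
    have "continuous_on (\<gamma> ` {0..1}) h"
      using h by (intro continuous_on_inv cont) auto
    then have "continuous_on (\<gamma> ` {0..1}) (\<lambda>z. (1 - h z) * G x + h z * G y)"
      by (intro continuous_intros)
    moreover have "G z = (1 - h z) * G x + h z * G y" if z: "z \<in> \<gamma> ` {0..1}" for z
    proof -
      obtain t where "t \<in> {0..1}" "z = \<gamma> t"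
        using z by blast
      then show ?thesis
        using h gcurveD(4)[OF \<gamma>] by simp
    qed
    ultimately show ?thesis
      by (simp cong: continuous_on_cong)
  qed
  have eq: "\<gamma> s = \<gamma> t" if "0 \<le> s" "s \<le> t" "t \<le> 1" "G (\<gamma> s) = G (\<gamma> t)" for s t
  proof (rule ccontr)
    assume "\<gamma> s \<noteq> \<gamma> t"
    then have "G (\<gamma> s) < G (\<gamma> t)"
      using that by (intro gauge_less Hin caus) auto
    then show False using that by simp
  qed
  show "inj_on G (\<gamma> ` {0..1})"
  proof (rule inj_onI)
    fix z w assume "z \<in> \<gamma> ` {0..1}" "w \<in> \<gamma> ` {0..1}" and G: "G z = G w"
    then obtain s t where st: "z = \<gamma> s" "w = \<gamma> t" "0 \<le> s" "s \<le> 1" "0 \<le> t" "t \<le> 1"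
      by auto
    show "z = w"
    proof (cases "s \<le> t")
      case True
      then show ?thesis using eq[of s t] st G by simp
    next
      case False
      then show ?thesis using eq[of t s] st G by simp
    qed
  qed
qed

lemma causal_pairs_borel:
  assumes "Hin \<in> sets borel"
  shows "causal_pairs \<in> sets borel"
proof -
  have "causal_pairs = Hin \<times> Hin \<inter> {(x, y). caus x y}"
    by (auto simp: causal_pairs_def)
  then show ?thesis
    using assms closed_caus by (auto intro!: sets.Int borel_Times)
qed

text \<open>The set is the projection of a closed set of triples, with the third component ranging
  over the diamond. Properness exhausts the triple product by the compact products of balls
  \<open>A n\<close>.\<close>

lemma hit_diamond_borel:
  assumes "closed K"
  shows "{p. {z\<in>H. caus (fst p) z \<and> caus z (snd p)} \<inter> K \<noteq> {}} \<in> sets borel"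
proof -
  define S :: "(('a \<times> 'a) \<times> 'a) set" where
    "S = snd -` (H \<inter> K) \<inter> (\<lambda>q. (fst (fst q), snd q)) -` {(x, y). caus x y}
      \<inter> (\<lambda>q. (snd q, snd (fst q))) -` {(x, y). caus x y}"
  fix a :: 'a
  define A :: "nat \<Rightarrow> (('a \<times> 'a) \<times> 'a) set" where
    "A n = (cball a n \<times> cball a n) \<times> cball a n" for n
  have "closed S"
    unfolding S_def using closed_H assms closed_caus
    by (intro closed_Int closed_vimage continuous_intros) auto
  moreover have "compact (A n)" for n
    unfolding A_def by (intro compact_Times proper)
  moreover have "(\<Union>n. A n) = UNIV"
  proof (intro set_eqI iffI UNIV_I)
    fix q :: "('a \<times> 'a) \<times> 'a"
    obtain n :: nat where "dist a (fst (fst q)) + dist a (snd (fst q)) + dist a (snd q) \<le> n"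
      using real_arch_simple by blast
    moreover have "0 \<le> dist a (fst (fst q))" "0 \<le> dist a (snd (fst q))" "0 \<le> dist a (snd q)"
      by simp_all
    ultimately have "dist a (fst (fst q)) \<le> n" "dist a (snd (fst q)) \<le> n" "dist a (snd q) \<le> n"
      by linarith+
    then have "q \<in> A n"
      by (cases q) (auto simp: A_def)
    then show "q \<in> (\<Union>n. A n)" by blast
  qed
  ultimately have "fst ` S \<in> sets borel"
    by (rule fst_image_closed_borel)
  moreover have "fst ` S = {p. {z\<in>H. caus (fst p) z \<and> caus z (snd p)} \<inter> K \<noteq> {}}"
  proof (intro set_eqI iffI)
    fix p assume "p \<in> {p. {z\<in>H. caus (fst p) z \<and> caus z (snd p)} \<inter> K \<noteq> {}}"
    then obtain z where "z \<in> H" "z \<in> K" "caus (fst p) z" "caus z (snd p)" by auto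
    then have "(p, z) \<in> S" by (simp add: S_def)
    then show "p \<in> fst ` S" by force
  qed (auto simp: S_def)
  ultimately show ?thesis by simp
qed

text \<open>The point at time \<open>t\<close> is the limit of those members of a dense sequence of measurable selections
  of the causal diamond whose gauge value is close to the prescribed one.\<close>

lemma geo_eval_measurable:
  assumes t: "t \<in> {0..1}"
  shows "(\<lambda>p. geo p t) \<in> borel_measurable (restrict_space borel causal_pairs)"
proof -
  define M where "M = restrict_space (borel :: ('a \<times> 'a) measure) causal_pairs"
  have space_M: "space M = causal_pairs"
    by (simp add: M_def space_restrict_space)
  define F where "F p = {z\<in>H. caus (fst p) z \<and> caus z (snd p)}" for p
  have F: "F p = geo p ` {0..1}" if "p \<in> space M" for p
    using geo_image that by (simp add: F_def space_M)
  have F_compact: "compact (F p)" and F_ne: "F p \<noteq> {}" if "p \<in> space M" for p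
    using gcurveD(1)[OF gcurve_geo, of p] that unfolding F[OF that] space_M
    by (auto simp: causal_curve_def intro: compact_continuous_image)
  have F_hit: "{p\<in>space M. F p \<inter> K \<noteq> {}} \<in> sets M" if "closed K" for K
  proof -
    have "{p\<in>space M. F p \<inter> K \<noteq> {}} = causal_pairs \<inter> {p. F p \<inter> K \<noteq> {}}"
      by (auto simp: space_M)
    then show ?thesis
      using hit_diamond_borel[OF that] unfolding M_def sets_restrict_space F_def by auto
  qed
  obtain z :: "nat \<Rightarrow> 'a \<times> 'a \<Rightarrow> 'a" where z: "\<And>n. z n \<in> borel_measurable M"
    "\<And>n p. p \<in> space M \<Longrightarrow> z n p \<in> F p"
    "\<And>p q e. p \<in> space M \<Longrightarrow> q \<in> F p \<Longrightarrow> e > 0 \<Longrightarrow> \<exists>n. dist (z n p) q < e"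
    by (rule compact_valued_dense_selections[OF F_compact F_ne F_hit]) blast+
  have G: "G \<in> borel_measurable (restrict_space borel Hin)"
    using gauge by (simp add: gauge_for_def)
  \<comment> \<open>\<open>G\<close> is Borel only on \<open>Hin\<close>, so it may be composed only
    with maps that stay there; the diamonds do.\<close>
  have G_comp: "(\<lambda>p. G (f p)) \<in> borel_measurable M"
    if "f \<in> borel_measurable M" "\<And>p. p \<in> space M \<Longrightarrow> f p \<in> Hin" for f
    using that by (intro measurable_compose[OF _ G] measurable_restrict_space2) auto
  have F_inner: "F p \<subseteq> Hin" if "p \<in> space M" for p
    using that between_inner[of "fst p" "snd p"] by (auto simp: F_def space_M causal_pairs_def)
  have Gz: "(\<lambda>p. G (z n p)) \<in> borel_measurable M" for n
    using z(1,2) F_inner by (intro G_comp) blast+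
  have proj: "fst \<in> borel_measurable M" "snd \<in> borel_measurable M"
    unfolding M_def
    by (intro measurable_restrict_space1 borel_measurable_continuous_onI continuous_intros)+
  define c where "c p = (1 - t) * G (fst p) + t * G (snd p)" for p
  have Gp: "(\<lambda>p. G (fst p)) \<in> borel_measurable M" "(\<lambda>p. G (snd p)) \<in> borel_measurable M"
    by (intro G_comp proj; auto simp: space_M causal_pairs_def)+
  have c: "c \<in> borel_measurable M"
    unfolding c_def by (intro borel_measurable_add borel_measurable_times borel_measurable_const Gp)
  \<comment> \<open>The first selection whose gauge is within \<open>1 / Suc k\<close> of the
    target; one exists by density of the selections and continuity of \<open>G\<close> on the
    diamond.\<close>
  define N where "N k p = (LEAST n. \<bar>G (z n p) - c p\<bar> < 1 / Suc k)" for k p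
  have N: "N k \<in> measurable M (count_space UNIV)" for k
    unfolding N_def using Gz c by measurable
  define f where "f k p = z (N k p) p" for k p
  have f: "f k \<in> borel_measurable M" for k
    unfolding f_def by (rule measurable_compose_countable[OF z(1) N])
  have lim: "(\<lambda>k. f k p) \<longlonglongrightarrow> geo p t" if p: "p \<in> space M" for p
  proof -
    note \<gamma> = gcurve_geo[OF p[unfolded space_M]]
    have image: "geo p ` {0..1} = F p" using F[OF p] by simp
    have G_cont: "continuous_on (F p) G" and G_inj: "inj_on G (F p)"
      using gauge_on_gcurve[OF \<gamma>] by (simp_all add: image)
    have geo_t: "geo p t \<in> F p" "G (geo p t) = c p"
      using gcurveD(4)[OF \<gamma> t] t unfolding image[symmetric] c_def by auto
    have close: "\<bar>G (f k p) - c p\<bar> < 1 / Suc k" for k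
    proof -
      have "0 < 1 / real (Suc k)" by simp
      then obtain d where d: "d > 0"
        "\<And>w. w \<in> F p \<Longrightarrow> dist w (geo p t) < d \<Longrightarrow> dist (G w) (G (geo p t)) < 1 / Suc k"
        using G_cont geo_t(1) unfolding continuous_on_iff by metis
      obtain n where "dist (z n p) (geo p t) < d"
        using z(3)[OF p geo_t(1) d(1)] by blast
      then have "\<bar>G (z n p) - c p\<bar> < 1 / Suc k"
        using d(2)[OF z(2)[OF p]] geo_t(2) by (simp add: dist_real_def)
      then show ?thesis
        unfolding f_def N_def by (rule LeastI)
    qed
    have f_F: "f k p \<in> F p" for k
      unfolding f_def using z(2)[OF p] .
    \<comment> \<open>On the compact diamond the inverse of the gauge is continuous, so convergence
      of gauge values forces convergence of the points.\<close>
    define h where "h = the_inv_into (F p) G"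
    have h: "h (G w) = w" if "w \<in> F p" for w
      unfolding h_def using G_inj that by (rule the_inv_into_f_f)
    have h_cont: "continuous_on (G ` F p) h"
      using h by (intro continuous_on_inv G_cont F_compact p) auto
    have "(\<lambda>k. G (f k p) - c p) \<longlonglongrightarrow> 0"
    proof (rule Lim_null_comparison)
      show "\<forall>\<^sub>F k in sequentially. norm (G (f k p) - c p) \<le> inverse (real (Suc k))"
        using close by (intro always_eventually allI) (simp add: less_imp_le inverse_eq_divide)
      show "(\<lambda>k. inverse (real (Suc k))) \<longlonglongrightarrow> 0"
        by (rule LIMSEQ_inverse_real_of_nat)
    qed
    then have "(\<lambda>k. G (f k p)) \<longlonglongrightarrow> G (geo p t)"
      unfolding geo_t(2) by (rule LIM_zero_cancel)
    then have "(\<lambda>k. h (G (f k p))) \<longlonglongrightarrow> h (G (geo p t))"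
      using f_F geo_t(1) by (intro continuous_on_tendsto_compose[OF h_cont]) auto
    then show ?thesis
      using f_F geo_t(1) by (simp add: h)
  qed
  show ?thesis
    unfolding M_def[symmetric] by (rule borel_measurable_LIMSEQ_metric[OF f lim])
qed

section \<open>Borel measurability of the set of \<open>G\<close>-causal curves\<close>

text \<open>For \<open>s < t\<close>, rational approximations are eventually separated by a number
  \<open>m\<close> in between, hence ordered; closedness of the causal relation passes to the
  limit.\<close>

lemma causal_curve_rationalI:
  assumes \<gamma>: "\<gamma> \<in> mspace (curve_space H)"
    and caus: "\<And>s t. s \<in> \<rat> \<inter> {0<..<1} \<Longrightarrow> t \<in> \<rat> \<inter> {0<..<1} \<Longrightarrow> s \<le> t \<Longrightarrow> caus (\<gamma> s) (\<gamma> t)"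
  shows "causal_curve caus {0..1} H \<gamma>"
proof -
  have cont: "continuous_on {0..1} \<gamma>" and sub: "\<gamma> ` {0..1} \<subseteq> H"
    using \<gamma> by (auto simp: mspace_curve_space)
  have "caus (\<gamma> s) (\<gamma> t)" if "s \<in> {0..1}" "t \<in> {0..1}" "s < t" for s t
  proof -
    have "s \<in> closure (\<rat> \<inter> {0<..<1})" "t \<in> closure (\<rat> \<inter> {0<..<1})"
      using that by (simp_all add: closure_rational_interval)
    then obtain S T where S: "\<And>n. S n \<in> \<rat> \<inter> {0<..<1}" "S \<longlonglongrightarrow> s"
      and T: "\<And>n. T n \<in> \<rat> \<inter> {0<..<1}" "T \<longlonglongrightarrow> t"
      unfolding closure_sequential by blast
    have lim: "(\<lambda>n. \<gamma> (S n)) \<longlonglongrightarrow> \<gamma> s" "(\<lambda>n. \<gamma> (T n)) \<longlonglongrightarrow> \<gamma> t"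
      using S T that
      by (auto intro!: continuous_on_tendsto_compose[OF cont] always_eventually simp: less_imp_le)
    obtain m where m: "s < m" "m < t"
      using dense[OF \<open>s < t\<close>] by blast
    have "\<forall>\<^sub>F n in sequentially. S n < m" "\<forall>\<^sub>F n in sequentially. m < T n"
      using order_tendstoD(2)[OF S(2) m(1)] order_tendstoD(1)[OF T(2) m(2)] by auto
    then have "\<forall>\<^sub>F n in sequentially. (\<gamma> (S n), \<gamma> (T n)) \<in> {(x, y). caus x y}"
      by eventually_elim (use S(1) T(1) in \<open>auto intro!: caus\<close>)
    then have "(\<gamma> s, \<gamma> t) \<in> {(x, y). caus x y}"
      by (rule Lim_in_closed_set[OF closed_caus _ sequentially_bot tendsto_Pair[OF lim]])
    then show ?thesis by simp
  qed
  then have "caus (\<gamma> s) (\<gamma> t)" if "s \<in> {0..1}" "t \<in> {0..1}" "s \<le> t" for s t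
    using that by (cases "s = t") auto
  then show ?thesis
    using cont sub by (auto simp: causal_curve_def is_interval_cc)
qed

text \<open>Monotonicity of the order and of the gauge along causal curves squeezes an arbitrary time between
  rational ones.\<close>

lemma gauge_affine_rationalI:
  assumes curve: "causal_curve caus {0..1} H \<gamma>"
    and inner: "\<And>t. t \<in> \<rat> \<inter> {0<..<1} \<Longrightarrow> \<gamma> t \<in> Hin"
    and affine: "\<And>t. t \<in> \<rat> \<inter> {0<..<1} \<Longrightarrow> G (\<gamma> t) = a * t + b"
    and t: "t \<in> {0<..<1}"
  shows "\<gamma> t \<in> Hin" "G (\<gamma> t) = a * t + b"
proof -
  have caus: "\<And>s t. 0 < s \<Longrightarrow> s < t \<Longrightarrow> t < 1 \<Longrightarrow> caus (\<gamma> s) (\<gamma> t)"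
    and sub: "\<gamma> t \<in> H"
    using curve t unfolding causal_curve_def by auto
  obtain r where r: "r \<in> \<rat>" "0 < r" "r < t"
    using Rats_dense_in_real[of 0 t] t by auto
  obtain s where s: "s \<in> \<rat>" "t < s" "s < 1"
    using Rats_dense_in_real[of t 1] t by auto
  show Hin: "\<gamma> t \<in> Hin"
  proof (rule between_inner[of "\<gamma> r" "\<gamma> s"])
    show "\<gamma> r \<in> Hin" "\<gamma> s \<in> Hin"
      using r s t by (intro inner; simp)+
    show "caus (\<gamma> r) (\<gamma> t)" "caus (\<gamma> t) (\<gamma> s)"
      using r s t by (intro caus; simp)+
  qed (rule sub)
  have "a * t + b \<le> G (\<gamma> t)"
  proof (rule continuous_le_on_closure[of "\<rat> \<inter> {0<..<t}" "\<lambda>r. a * r + b" t])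
    fix r assume "r \<in> \<rat> \<inter> {0<..<t}"
    then have r: "r \<in> \<rat> \<inter> {0<..<1}" "0 < r" "r < t" using t by auto
    then have "G (\<gamma> r) \<le> G (\<gamma> t)"
      using t by (intro gauge_le inner Hin caus) auto
    then show "a * r + b \<le> G (\<gamma> t)"
      using affine[OF r(1)] by simp
  qed (use t in \<open>auto simp: closure_rational_interval intro!: continuous_intros\<close>)
  moreover have "a * t + b \<ge> G (\<gamma> t)"
  proof (rule continuous_ge_on_closure[of "\<rat> \<inter> {t<..<1}" "\<lambda>r. a * r + b" t])
    fix r assume "r \<in> \<rat> \<inter> {t<..<1}"
    then have r: "r \<in> \<rat> \<inter> {0<..<1}" "t < r" "r < 1" using t by auto
    then have "G (\<gamma> t) \<le> G (\<gamma> r)"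
      using t by (intro gauge_le inner Hin caus) auto
    then show "a * r + b \<ge> G (\<gamma> t)"
      using affine[OF r(1)] by simp
  qed (use t in \<open>auto simp: closure_rational_interval intro!: continuous_intros\<close>)
  ultimately show "G (\<gamma> t) = a * t + b" by simp
qed

text \<open>Being constant, or being causal, inner and affinely gauged, can be tested at the
  countably many rational times of the open interval.\<close>

lemma Caus_G_borel:
  assumes Hin: "Hin \<in> sets borel"
  shows "Caus_G caus H G \<in> sets (curve_borel H)"
proof -
  let ?N = "curve_borel H"
  define T :: "real set" where "T = \<rat> \<inter> {0<..<1}"
  have T: "countable T" "T \<subseteq> {0..1}" "1/2 \<in> T" "1/4 \<in> T" "3/4 \<in> T"
    unfolding T_def by (auto simp: countable_rat)
  have T_closure: "closure T = {0..1}"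
    by (simp add: T_def closure_rational_interval)
  \<comment> \<open>The value \<open>0\<close> off \<open>Hin\<close> turns the gauge into a Borel
    function on the whole space.\<close>
  define g where "g x = (if x \<in> Hin then G x else 0)" for x
  have g: "g \<in> borel_measurable borel"
    unfolding g_def using gauge Hin
    by (subst measurable_If_restrict_space_iff) (auto simp: gauge_for_def)
  have eval: "(\<lambda>\<gamma>. \<gamma> t) \<in> borel_measurable ?N" if "t \<in> T" for t
    using that T(2) by (intro measurable_eval) auto
  have g_eval: "(\<lambda>\<gamma>. g (\<gamma> t)) \<in> borel_measurable ?N" if "t \<in> T" for t
    using measurable_compose[OF eval[OF that] g] .
  \<comment> \<open>Slope \<open>k\<close> and intercept \<open>l\<close> are recovered from the
    values at \<open>1/4\<close> and \<open>3/4\<close>, which removes the existential quantifier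
    over the coefficients.\<close>
  define k where "k \<gamma> = 2 * (g (\<gamma> (3/4)) - g (\<gamma> (1/4)))" for \<gamma> :: "real \<Rightarrow> 'a"
  define l where "l \<gamma> = g (\<gamma> (1/4)) - k \<gamma> / 4" for \<gamma> :: "real \<Rightarrow> 'a"
  define A where "A = {\<gamma>\<in>space ?N. \<forall>t\<in>T. \<gamma> t = \<gamma> (1/2)}"
  define B1 where "B1 = {\<gamma>\<in>space ?N. \<forall>s\<in>T. \<forall>t\<in>T. s \<le> t \<longrightarrow> caus (\<gamma> s) (\<gamma> t)}"
  define B2 where "B2 = {\<gamma>\<in>space ?N. \<forall>t\<in>T. \<gamma> t \<in> Hin}"
  define B3 where "B3 = {\<gamma>\<in>space ?N. \<forall>t\<in>T. g (\<gamma> t) = k \<gamma> * t + l \<gamma>}"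
  have "A \<in> sets ?N"
    unfolding A_def
  proof (rule sets.sets_Collect_countable_All'[OF _ T(1)])
    fix t assume "t \<in> T"
    then have "(\<lambda>\<gamma>. dist (\<gamma> t) (\<gamma> (1/2))) \<in> borel_measurable ?N"
      using T(3) by (intro borel_measurable_dist eval)
    then have "{\<gamma>\<in>space ?N. dist (\<gamma> t) (\<gamma> (1/2)) = 0} \<in> sets ?N"
      by measurable
    then show "{\<gamma>\<in>space ?N. \<gamma> t = \<gamma> (1/2)} \<in> sets ?N"
      by simp
  qed
  moreover have "B1 \<in> sets ?N"
    unfolding B1_def
  proof (intro sets.sets_Collect_countable_All'[OF _ T(1)])
    fix s t assume st: "s \<in> T" "t \<in> T"
    show "{\<gamma>\<in>space ?N. s \<le> t \<longrightarrow> caus (\<gamma> s) (\<gamma> t)} \<in> sets ?N"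
    proof (cases "s \<le> t")
      case True
      have "(\<lambda>\<gamma>. (\<gamma> s, \<gamma> t)) \<in> borel_measurable ?N"
        using st by (intro borel_measurable_Pair eval)
      then have "(\<lambda>\<gamma>. (\<gamma> s, \<gamma> t)) -` {(x, y). caus x y} \<inter> space ?N \<in> sets ?N"
        using closed_caus by (intro measurable_sets) auto
      moreover have "(\<lambda>\<gamma>. (\<gamma> s, \<gamma> t)) -` {(x, y). caus x y} \<inter> space ?N =
          {\<gamma>\<in>space ?N. s \<le> t \<longrightarrow> caus (\<gamma> s) (\<gamma> t)}"
        using True by auto
      ultimately show ?thesis by (simp only:)
    next
      case False
      then have "{\<gamma>\<in>space ?N. s \<le> t \<longrightarrow> caus (\<gamma> s) (\<gamma> t)} = space ?N"
        by blast
      then show ?thesis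
        by (simp only: sets.top)
    qed
  qed
  moreover have "B2 \<in> sets ?N"
    unfolding B2_def
  proof (rule sets.sets_Collect_countable_All'[OF _ T(1)])
    fix t assume "t \<in> T"
    then have "(\<lambda>\<gamma>. \<gamma> t) -` Hin \<inter> space ?N \<in> sets ?N"
      by (intro measurable_sets[OF eval] Hin)
    moreover have "(\<lambda>\<gamma>. \<gamma> t) -` Hin \<inter> space ?N = {\<gamma>\<in>space ?N. \<gamma> t \<in> Hin}"
      by auto
    ultimately show "{\<gamma>\<in>space ?N. \<gamma> t \<in> Hin} \<in> sets ?N"
      by (simp only:)
  qed
  moreover have "B3 \<in> sets ?N"
    unfolding B3_def
  proof (rule sets.sets_Collect_countable_All'[OF _ T(1)])
    fix t assume "t \<in> T"
    note [measurable] = g_eval[OF this] g_eval[OF T(4)] g_eval[OF T(5)]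
    show "{\<gamma>\<in>space ?N. g (\<gamma> t) = k \<gamma> * t + l \<gamma>} \<in> sets ?N"
      unfolding k_def l_def by measurable
  qed
  ultimately have "A \<union> (B1 \<inter> B2 \<inter> B3) \<in> sets ?N"
    by auto
  moreover have "Caus_G caus H G = A \<union> (B1 \<inter> B2 \<inter> B3)"
  proof (intro equalityI subsetI)
    fix \<gamma> assume \<gamma>: "\<gamma> \<in> Caus_G caus H G"
    then have "\<gamma> \<in> space ?N"
      by (simp add: Caus_G_def space_curve_borel)
    show "\<gamma> \<in> A \<union> (B1 \<inter> B2 \<inter> B3)"
    proof (cases "\<exists>x. \<forall>t\<in>{0..1}. \<gamma> t = x")
      case True
      then obtain x where "\<And>t. t \<in> T \<Longrightarrow> \<gamma> t = x"
        using T(2) by blast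
      then have "\<gamma> \<in> A"
        using \<open>\<gamma> \<in> space ?N\<close> T(3) unfolding A_def by simp
      then show ?thesis by blast
    next
      case False
      then obtain a b where curve: "causal_curve caus {0..1} H \<gamma>"
        and inner: "\<gamma> ` {0<..<1} \<subseteq> Hin"
        and ab: "\<And>t. t \<in> {0<..<1} \<Longrightarrow> G (\<gamma> t) = a * t + b"
        using \<gamma> unfolding Caus_G_def by blast
      have "\<gamma> \<in> B1"
        using curve \<open>\<gamma> \<in> space ?N\<close> T(2) unfolding B1_def causal_curve_def by blast
      moreover have "\<gamma> \<in> B2"
        using inner \<open>\<gamma> \<in> space ?N\<close> by (auto simp: B2_def T_def)
      moreover have "g (\<gamma> t) = a * t + b" if "t \<in> T" for t
      proof -
        have "t \<in> {0<..<1}" using that by (simp add: T_def)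
        then have "G (\<gamma> t) = a * t + b" "\<gamma> t \<in> Hin"
          using ab inner by blast+
        then show ?thesis
          by (simp add: g_def)
      qed
      then have "\<gamma> \<in> B3"
        using T(4,5) \<open>\<gamma> \<in> space ?N\<close> by (simp add: B3_def k_def l_def)
      ultimately show ?thesis by blast
    qed
  next
    fix \<gamma> assume "\<gamma> \<in> A \<union> (B1 \<inter> B2 \<inter> B3)"
    then show "\<gamma> \<in> Caus_G caus H G"
    proof
      assume "\<gamma> \<in> A"
      then have \<gamma>: "\<gamma> \<in> mspace (curve_space H)" "\<And>t. t \<in> T \<Longrightarrow> \<gamma> t = \<gamma> (1/2)"
        unfolding A_def space_curve_borel by auto
      have cont: "continuous_on (closure T) \<gamma>"
        using \<gamma>(1) by (simp add: mspace_curve_space T_closure)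
      have "\<forall>t\<in>{0..1}. \<gamma> t = \<gamma> (1/2)"
        using continuous_constant_on_closure[OF cont \<gamma>(2)] unfolding T_closure by blast
      then show ?thesis
        using \<gamma>(1) unfolding Caus_G_def by blast
    next
      assume B: "\<gamma> \<in> B1 \<inter> B2 \<inter> B3"
      then have \<gamma>: "\<gamma> \<in> mspace (curve_space H)"
        by (simp add: B1_def space_curve_borel)
      have curve: "causal_curve caus {0..1} H \<gamma>"
        using B \<gamma> by (intro causal_curve_rationalI) (auto simp: B1_def T_def)
      have inner: "\<gamma> t \<in> Hin" if "t \<in> \<rat> \<inter> {0<..<1}" for t
        using B that by (simp add: B2_def T_def)
      have affine: "G (\<gamma> t) = k \<gamma> * t + l \<gamma>" if t: "t \<in> \<rat> \<inter> {0<..<1}" for t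
      proof -
        have "g (\<gamma> t) = k \<gamma> * t + l \<gamma>"
          using B t by (simp add: B3_def T_def)
        then show ?thesis
          using inner[OF t] by (simp add: g_def)
      qed
      show ?thesis
        using \<gamma> curve gauge_affine_rationalI[OF curve inner affine] unfolding Caus_G_def by blast
    qed
  qed
  ultimately show ?thesis by simp
qed

section \<open>Total extension of the connecting curve\<close>

text \<open>The default is a constant curve, which is itself \<open>G\<close>-causal once
  \<open>H\<close> is nonempty, so the map takes values in \<open>Caus_G\<close> everywhere.\<close>

definition geo_map :: "'a \<times> 'a \<Rightarrow> real \<Rightarrow> 'a" where
  "geo_map p = (if p \<in> causal_pairs then geo p else restrict (\<lambda>_. SOME x. x \<in> H) {0..1})"

lemma geo_map_in_Caus_G:
  assumes "H \<noteq> {}"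
  shows "geo_map p \<in> Caus_G caus H G"
proof (cases "p \<in> causal_pairs")
  case True
  then show ?thesis by (simp add: geo_map_def geo_in_Caus_G)
next
  case False
  have "(SOME x. x \<in> H) \<in> H"
    using assms by (simp add: some_in_eq)
  then have "restrict (\<lambda>_::real. SOME x. x \<in> H) {0..1} \<in> mspace (curve_space H)"
    by (auto simp: mspace_curve_space intro: continuous_on_eq[OF continuous_on_const])
  then show ?thesis
    using False by (auto simp: geo_map_def Caus_G_def)
qed

lemma geo_map_measurable:
  assumes "H \<noteq> {}" "Hin \<in> sets borel"
  shows "geo_map \<in> measurable borel (curve_borel H)"
proof (rule measurable_curve_borelI)
  show "geo_map p \<in> mspace (curve_space H)" for p
    using geo_map_in_Caus_G[OF assms(1), of p] by (simp add: Caus_G_def)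
  fix t :: real assume t: "t \<in> {0..1}"
  have "(\<lambda>p. if p \<in> causal_pairs then geo p t else (SOME x. x \<in> H)) \<in> borel_measurable borel"
    using causal_pairs_borel[OF assms(2)] geo_eval_measurable[OF t]
    by (subst measurable_If_restrict_space_iff) auto
  moreover have "geo_map p t = (if p \<in> causal_pairs then geo p t else (SOME x. x \<in> H))" for p
    using t by (simp add: geo_map_def)
  ultimately show "(\<lambda>p. geo_map p t) \<in> borel_measurable borel"
    by simp
qed

end

section \<open>Existence and uniqueness of the plan with prescribed endpoint law\<close>

theorem proposition6p5:
  fixes chron caus :: "'a::polish_space \<Rightarrow> 'a \<Rightarrow> bool"
    and H :: "'a set" and G :: "'a \<Rightarrow> real"
    and \<mu>0 \<mu>1 :: "'a measure" and \<pi> :: "('a \<times> 'a) measure"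
  assumes "topological_causal_space chron caus"
    and "null_nonbranching caus H"
    and "weakly_convex caus H"
    and "closed H"
    and "achronal chron H"
    and "gauge_for caus H G"
    and "borel_prob_on (inner_points caus H) \<mu>0"
    and "borel_prob_on (inner_points caus H) \<mu>1"
    and "\<pi> \<in> causal_couplings caus \<mu>0 \<mu>1"
  shows "\<exists>!\<nu>. \<nu> \<in> OptGeo caus H G \<mu>0 \<mu>1 \<and> distr \<nu> borel (\<lambda>\<gamma>. (\<gamma> 0, \<gamma> 1)) = \<pi>"
proof -
  interpret topological_causal_space chron caus by fact
  interpret gauged_achronal_set chron caus H G
    using assms by unfold_locales (auto simp: null_nonbranching_def)
  let ?N = "curve_borel H" and ?e = "\<lambda>\<gamma>::real \<Rightarrow> 'a. (\<gamma> 0, \<gamma> 1)"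
  have \<mu>: "prob_space \<mu>0" "prob_space \<mu>1" "emeasure \<mu>0 Hin = 1" "emeasure \<mu>1 Hin = 1"
    "sets \<mu>0 = sets borel"
    using assms(7,8) by (auto simp: borel_prob_on_def)
  have \<pi>: "prob_space \<pi>" "sets \<pi> = sets borel" "distr \<pi> borel fst = \<mu>0" "distr \<pi> borel snd = \<mu>1"
    "emeasure \<pi> {(x, y). caus x y} = 1"
    using assms(9) by (auto simp: causal_couplings_def)
  have AE_1: "AE x in M. x \<in> A" if "prob_space M" "emeasure M A = 1" for M and A :: "'b set"
    using prob_space.AE_prob_1[OF that(1)] that(2) by (simp add: measure_def)
  \<comment> \<open>Measurability comes from the mass: a set outside the \<sigma>-algebra has
    \<open>emeasure\<close> zero.\<close>
  have Hin: "Hin \<in> sets borel"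
    using \<mu>(3,5) emeasure_notin_sets[of Hin \<mu>0] by fastforce
  have "Hin \<noteq> {}"
    using \<mu>(3) by auto
  then have "H \<noteq> {}"
    using inner_subset by blast
  have proj: "fst \<in> borel_measurable \<pi>" "snd \<in> borel_measurable \<pi>"
    unfolding measurable_cong_sets[OF \<pi>(2) refl]
    by (intro borel_measurable_continuous_onI continuous_intros)+
  have AE_pairs: "AE p in \<pi>. p \<in> causal_pairs"
  proof -
    have "AE p in \<pi>. fst p \<in> Hin"
      using AE_1[OF \<mu>(1,3)] proj(1) unfolding \<pi>(3)[symmetric] by (rule AE_distrD[rotated])
    moreover have "AE p in \<pi>. snd p \<in> Hin"
      using AE_1[OF \<mu>(2,4)] proj(2) unfolding \<pi>(4)[symmetric] by (rule AE_distrD[rotated])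
    moreover have "AE p in \<pi>. p \<in> {(x, y). caus x y}"
      by (rule AE_1[OF \<pi>(1,5)])
    ultimately show ?thesis
      by eventually_elim (auto simp: causal_pairs_def)
  qed
  have geo: "geo_map \<in> measurable \<pi> ?N"
    unfolding measurable_cong_sets[OF \<pi>(2) refl] by (rule geo_map_measurable[OF \<open>H \<noteq> {}\<close> Hin])
  have e: "?e \<in> borel_measurable ?N"
    by (intro borel_measurable_Pair measurable_eval) auto
  define \<nu>\<^sub>0 where "\<nu>\<^sub>0 = distr \<pi> ?N geo_map"
  have e_geo: "distr \<nu>\<^sub>0 borel ?e = \<pi>"
  proof -
    have "distr \<nu>\<^sub>0 borel ?e = distr \<pi> borel (?e \<circ> geo_map)"
      unfolding \<nu>\<^sub>0_def by (rule distr_distr[OF e geo])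
    also have "\<dots> = distr \<pi> borel (\<lambda>p. p)"
    proof (rule distr_cong_AE)
      show "AE p in \<pi>. (?e \<circ> geo_map) p = p"
        using AE_pairs
      proof eventually_elim
        case (elim p)
        then show ?case
          using gcurveD(2,3)[OF gcurve_geo[OF elim]] by (simp add: geo_map_def)
      qed
      show "?e \<circ> geo_map \<in> borel_measurable \<pi>"
        by (rule measurable_comp[OF geo e])
      show "(\<lambda>p. p) \<in> borel_measurable \<pi>"
        unfolding measurable_cong_sets[OF \<pi>(2) refl] by simp
    qed auto
    also have "\<dots> = \<pi>"
      by (rule distr_id2) (simp add: \<pi>(2))
    finally show ?thesis .
  qed
  have marginals: "distr \<nu> borel (\<lambda>\<gamma>. \<gamma> 0) = \<mu>0" "distr \<nu> borel (\<lambda>\<gamma>. \<gamma> 1) = \<mu>1"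
    if "sets \<nu> = sets ?N" "distr \<nu> borel ?e = \<pi>" for \<nu>
  proof -
    have e': "?e \<in> borel_measurable \<nu>"
      using e unfolding measurable_cong_sets[OF that(1) refl] .
    have proj': "(fst :: 'a \<times> 'a \<Rightarrow> 'a) \<in> measurable borel borel"
      "(snd :: 'a \<times> 'a \<Rightarrow> 'a) \<in> measurable borel borel"
      using proj unfolding measurable_cong_sets[OF \<pi>(2) refl] by auto
    have "distr \<pi> borel fst = distr \<nu> borel (fst \<circ> ?e)" "distr \<pi> borel snd = distr \<nu> borel (snd \<circ> ?e)"
      unfolding that(2)[symmetric] by (intro distr_distr proj' e')+
    then show "distr \<nu> borel (\<lambda>\<gamma>. \<gamma> 0) = \<mu>0" "distr \<nu> borel (\<lambda>\<gamma>. \<gamma> 1) = \<mu>1"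
      by (simp_all add: \<pi>(3,4) comp_def)
  qed
  show ?thesis
  proof (rule ex1I[of _ \<nu>\<^sub>0], intro conjI e_geo)
    have "emeasure \<nu>\<^sub>0 (Caus_G caus H G) = emeasure \<pi> (geo_map -` Caus_G caus H G \<inter> space \<pi>)"
      unfolding \<nu>\<^sub>0_def by (rule emeasure_distr[OF geo Caus_G_borel[OF Hin]])
    also have "geo_map -` Caus_G caus H G \<inter> space \<pi> = space \<pi>"
      using geo_map_in_Caus_G[OF \<open>H \<noteq> {}\<close>] by auto
    also have "emeasure \<pi> (space \<pi>) = 1"
      by (rule prob_space.emeasure_space_1[OF \<pi>(1)])
    finally show "\<nu>\<^sub>0 \<in> OptGeo caus H G \<mu>0 \<mu>1"
      using marginals[of \<nu>\<^sub>0] e_geo prob_space.prob_space_distr[OF \<pi>(1) geo]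
      by (simp add: OptGeo_def \<nu>\<^sub>0_def)
  next
    fix \<nu> assume \<nu>: "\<nu> \<in> OptGeo caus H G \<mu>0 \<mu>1 \<and> distr \<nu> borel ?e = \<pi>"
    then have prob: "prob_space \<nu>" and sets: "sets \<nu> = sets ?N"
      and Caus: "emeasure \<nu> (Caus_G caus H G) = 1" and e_\<nu>: "distr \<nu> borel ?e = \<pi>"
      by (auto simp: OptGeo_def)
    have e': "?e \<in> borel_measurable \<nu>"
      using e unfolding measurable_cong_sets[OF sets refl] .
    have geo': "geo_map \<in> measurable borel ?N"
      using geo unfolding measurable_cong_sets[OF \<pi>(2) refl] .
    have "AE \<gamma> in \<nu>. ?e \<gamma> \<in> causal_pairs"
      using e' AE_pairs unfolding e_\<nu>[symmetric] by (rule AE_distrD)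
    \<comment> \<open>Almost every curve is \<open>G\<close>-causal with endpoints in
      \<open>causal_pairs\<close>, hence recovered from them by \<open>geo_map\<close>. So any
      admissible plan is the push-forward of its endpoint law, which is \<pi>.\<close>
    with AE_1[OF prob Caus] have ae: "AE \<gamma> in \<nu>. (geo_map \<circ> ?e) \<gamma> = \<gamma>"
      by eventually_elim (simp add: geo_map_def Caus_G_eq_geo)
    have "\<nu>\<^sub>0 = distr \<nu> ?N (geo_map \<circ> ?e)"
      unfolding \<nu>\<^sub>0_def e_\<nu>[symmetric] by (rule distr_distr[OF geo' e'])
    also have "\<dots> = distr \<nu> ?N (\<lambda>\<gamma>. \<gamma>)"
    proof (rule distr_cong_AE[OF refl refl ae])
      show "geo_map \<circ> ?e \<in> measurable \<nu> ?N"
        by (rule measurable_comp[OF e' geo'])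
      show "(\<lambda>\<gamma>. \<gamma>) \<in> measurable \<nu> ?N"
        unfolding measurable_cong_sets[OF sets refl] by simp
    qed
    also have "\<dots> = \<nu>"
      by (rule distr_id2[OF sets[symmetric]])
    finally show "\<nu> = \<nu>\<^sub>0" ..
  qed
qed

end
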